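(* Let $p\ge 0$ and $q\ge 1$ be integers, let $n_{ij}$ ($1\le i\le p$, $1\le j\le s_i$) be positive integers with $n_{i1}\ge n_{i2}\ge\dots\ge n_{is_i}$, and let $k_1,\dots,k_q$ be positive integers. Then there exist a manifold $M$ and a Poisson pencil $\mathcal P=\{\mathcal A+\lambda\mathcal B\}$ on $M$ such that: (1) at every point $x\in M$ the Jordan–Kronecker invariants of $\mathcal P$ consist of the Jordan tuples $J_{\lambda_i(x)}(2n_{i1},\dots,2n_{is_i})$, $i=1,\dots,p$, and the Kronecker sizes $2k_1-1,\dots,2k_q-1$; (2) the eigenvalues $\lambda_1(x),\dots,\lambda_p(x)$ are pairwise distinct and $d\lambda_i(x)\neq 0$ for every $x\in M$ and every $i$.
   Context: Manifolds are either complex (all objects holomorphic) or real $C^\infty$. Two Poisson bivectors $\mathcal A,\mathcal B$ on $M$ are compatible if every linear combination $\alpha\mathcal A+\beta\mathcal B$ with constant coefficients is Poisson; the family $\{\mathcal A+\lambda\mathcal B\}$ (with $\mathcal A_\infty=\mathcal B$) is then a Poisson pencil. At each $x\in M$, $\mathcal A(x),\mathcal B(x)$ are skew-symmetric forms on $T_x^*M$. Jordan–Kronecker theorem: for a pair of skew forms $A,B$ on a finite-dimensional complex vector space there is a basis in which both are block-diagonal with corresponding blocks $(A_i,B_i)$ of one of the types: Jordan $2n\times 2n$ block with eigenvalue $\mu\in\mathbb C$: $A_i=\begin{pmatrix}0&J_\mu\\-J_\mu^T&0\end{pmatrix}$, $B_i=\begin{pmatrix}0&I_n\\-I_n&0\end{pmatrix}$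 ($J_\mu$ the $n\times n$ upper-triangular Jordan block); Jordan block with eigenvalue $\infty$ (same with $A_i$, $B_i$ swapped); Kronecker $(2k-1)\times(2k-1)$ block, $k\ge1$: $A_i=\begin{pmatrix}0&P\\-P^T&0\end{pmatrix}$, $B_i=\begin{pmatrix}0&Q\\-Q^T&0\end{pmatrix}$ with $P=(I_{k-1}\,|\,0)$, $Q=(0\,|\,I_{k-1})$ of size $(k-1)\times k$ (for $k=1$ both are $1\times1$ zero). The numbers and sizes of blocks, grouped by eigenvalue, are uniquely determined. The eigenvalues are exactly the $\mu$ with $\operatorname{rk}(A-\mu B)<\max_\lambda\operatorname{rk}(A+\lambda B)$. The JK invariants of the pair are the Kronecker sizes $2k-1$ of the Kronecker blocks and, for each distinct eigenvalue $\lambda_i$, the Jordan tuple $J_{\lambda_i}(2n_{i1},\dots,2n_{is_i})$ listing the sizes ($n_{i1}\ge\dots\ge n_{is_i}$) of the Jordan blocks with eigenvalue $\lambda_i$. The JK invariants of $\mathcal P$ at $x$ are those of $(\mathcal A(x),\mathcal B(x))$; the eigenvalues at $x$ are denoted $\lambda_i(x)$. *)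

theory Defs
  imports "HOL-Analysis.Analysis"
begin

text \<open>Real C-infinity setting. Manifold = nonempty open subset of real^'n (coordinates x_1..x_N).
  Partial derivative of a real function in coordinate direction i.\<close>

definition partial_at :: "(real^'n \<Rightarrow> real) \<Rightarrow> 'n \<Rightarrow> real^'n \<Rightarrow> real" where
  "partial_at f i x = frechet_derivative f (at x) (axis i 1)"

definition Cinf_on :: "(real^'n) set \<Rightarrow> (real^'n \<Rightarrow> real) \<Rightarrow> bool" where
  "Cinf_on U f \<longleftrightarrow> (\<exists>S. f \<in> S \<and> (\<forall>g\<in>S. (\<forall>x\<in>U. g differentiable (at x)) \<and>
                                 (\<forall>i. (\<lambda>x. partial_at g i x) \<in> S)))"

text \<open>A bivector field on U given by its coefficient matrix P x $ i $ j = P^{ij}(x)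
  (the value of P(x) on dx_i, dx_j). It is Poisson iff it is skew, smooth and satisfies
  the Jacobi identity  sum_l (P^{li} d_l P^{jk} + P^{lj} d_l P^{ki} + P^{lk} d_l P^{ij}) = 0.\<close>

definition poisson_on :: "(real^'n) set \<Rightarrow> (real^'n \<Rightarrow> real^'n^'n) \<Rightarrow> bool" where
  "poisson_on U P \<longleftrightarrow>
     (\<forall>x\<in>U. \<forall>i j. P x $ i $ j = - (P x $ j $ i)) \<and>
     (\<forall>i j. Cinf_on U (\<lambda>x. P x $ i $ j)) \<and>
     (\<forall>x\<in>U. \<forall>i j k.
        (\<Sum>l\<in>UNIV. P x $ l $ i * partial_at (\<lambda>y. P y $ j $ k) l x
                   + P x $ l $ j * partial_at (\<lambda>y. P y $ k $ i) l x
                   + P x $ l $ k * partial_at (\<lambda>y. P y $ i $ j) l x) = 0)"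

definition compatible_poisson_on :: "(real^'n) set \<Rightarrow> (real^'n \<Rightarrow> real^'n^'n) \<Rightarrow> (real^'n \<Rightarrow> real^'n^'n) \<Rightarrow> bool" where
  "compatible_poisson_on U A B \<longleftrightarrow>
     (\<forall>\<alpha> \<beta> :: real. poisson_on U (\<lambda>x. \<alpha> *\<^sub>R A x + \<beta> *\<^sub>R B x))"

text \<open>Skew matrix [[0,F],[-F^T,0]] whose upper-left zero block has size m (entries indexed from 0).\<close>

definition offblock :: "nat \<Rightarrow> (nat \<Rightarrow> nat \<Rightarrow> complex) \<Rightarrow> nat \<Rightarrow> nat \<Rightarrow> complex" where
  "offblock m F r s = (if r < m \<and> m \<le> s then F r (s - m)
                       else if m \<le> r \<and> s < m then - F s (r - m) else 0)"

fun blockdiag :: "(nat \<times> (nat \<Rightarrow> nat \<Rightarrow> complex)) list \<Rightarrow> nat \<Rightarrow> nat \<Rightarrow> complex" where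
  "blockdiag [] r s = 0"
| "blockdiag ((m, F) # bs) r s =
     (if r < m \<and> s < m then F r s
      else if m \<le> r \<and> m \<le> s then blockdiag bs (r - m) (s - m) else 0)"

definition jordan_A :: "complex \<Rightarrow> nat \<Rightarrow> nat \<times> (nat \<Rightarrow> nat \<Rightarrow> complex)" where
  "jordan_A \<mu> n = (2 * n, offblock n (\<lambda>r c. if c = r then \<mu> else if c = r + 1 then 1 else 0))"

definition jordan_B :: "nat \<Rightarrow> nat \<times> (nat \<Rightarrow> nat \<Rightarrow> complex)" where
  "jordan_B n = (2 * n, offblock n (\<lambda>r c. if c = r then 1 else 0))"

text \<open>Kronecker (2k-1) x (2k-1) block pair: P = (I_{k-1} | 0), Q = (0 | I_{k-1}).\<close>

definition kron_A :: "nat \<Rightarrow> nat \<times> (nat \<Rightarrow> nat \<Rightarrow> complex)" where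
  "kron_A k = (2 * k - 1, offblock (k - 1) (\<lambda>r c. if c = r then 1 else 0))"

definition kron_B :: "nat \<Rightarrow> nat \<times> (nat \<Rightarrow> nat \<Rightarrow> complex)" where
  "kron_B k = (2 * k - 1, offblock (k - 1) (\<lambda>r c. if c = r + 1 then 1 else 0))"

text \<open>The pair of skew forms (A,B) on C^'n (matrices w.r.t. a basis) has JK normal form given by
  Jordan blocks with eigenvalue mu i of sizes 2 n i j (i = 1..p, j = 1..s i) and Kronecker blocks of
  sizes 2 k j - 1 (j = 1..q): there is a basis (invertible C, enumerated by a bijection e with
  {0..<N}) in which both forms are simultaneously this block-diagonal normal form.\<close>

definition JK_normal_form ::
  "complex^'n^'n \<Rightarrow> complex^'n^'n \<Rightarrow> nat \<Rightarrow> (nat \<Rightarrow> complex) \<Rightarrow> (nat \<Rightarrow> nat) \<Rightarrow> (nat \<Rightarrow> nat \<Rightarrow> nat)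
     \<Rightarrow> nat \<Rightarrow> (nat \<Rightarrow> nat) \<Rightarrow> bool" where
  "JK_normal_form A B p \<mu> s n q k \<longleftrightarrow>
     (let jA = concat (map (\<lambda>i. map (\<lambda>j. jordan_A (\<mu> i) (n i j)) [1..<s i + 1]) [1..<p + 1]);
          jB = concat (map (\<lambda>i. map (\<lambda>j. jordan_B (n i j)) [1..<s i + 1]) [1..<p + 1]);
          kA = map (\<lambda>j. kron_A (k j)) [1..<q + 1];
          kB = map (\<lambda>j. kron_B (k j)) [1..<q + 1];
          N = sum_list (map fst (jA @ kA))
      in \<exists>(C :: complex^'n^'n) (e :: 'n \<Rightarrow> nat).
           invertible C \<and> bij_betw e UNIV {..<N} \<and>
           (\<forall>a b. (transpose C ** A ** C) $ a $ b = blockdiag (jA @ kA) (e a) (e b)) \<and>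
           (\<forall>a b. (transpose C ** B ** C) $ a $ b = blockdiag (jB @ kB) (e a) (e b)))"

definition cmat :: "real^'n^'n \<Rightarrow> complex^'n^'n" where
  "cmat M = (\<chi> i j. complex_of_real (M $ i $ j))"

end

theory Submission
  imports Defs
begin

text \<open>
  Let \<open>x\<^sub>r\<close>, \<open>y\<^sub>j\<close> (\<open>r < K\<close>, \<open>j \<le> K\<close>, \<open>K = k\<^sub>1 - 1\<close>) be the coordinates of the first Kronecker block.
  The eigenvalues are the functions solving \<open>\<lambda>\<^sub>i = i + (\<Sum>j\<le>K. y\<^sub>j \<lambda>\<^sub>i\<^bsup>K-j\<^esup>)\<close> near \<open>y = 0\<close>. Then
  \<open>\<partial>\<^sub>j \<lambda>\<^sub>i = \<lambda>\<^sub>i \<partial>\<^bsub>j+1\<^esub> \<lambda>\<^sub>i\<close>, that is, \<open>d\<lambda>\<^sub>i\<close> lies in the kernel of \<open>A - \<lambda>\<^sub>i B\<close>.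
  \<open>B\<close> is the constant normal form, and \<open>A\<close> is the normal form with eigenvalues \<open>\<lambda>\<^sub>i\<close> plus the terms
  \<open>{x\<^sub>r, \<xi>\<^sub>a} = \<omega>\<^sub>a (\<partial>\<^bsub>r+1\<^esub> \<lambda>\<^sub>i) \<xi>\<^sub>a\<close> for the coordinates \<open>\<xi>\<^sub>a\<close> of the Jordan blocks with eigenvalue \<open>\<lambda>\<^sub>i\<close>.
  The weights \<open>\<omega>\<^sub>a\<close> grade a Jordan block so that entries of \<open>B\<close> have total weight 1 and the nilpotent
  entries of \<open>A\<close> total weight 0; this is what the Jacobi identity for \<open>x, \<xi>, \<xi>\<close> requires, while the one for
  \<open>x, x, \<xi>\<close> holds because \<open>\<partial>\<^sub>a \<partial>\<^sub>b \<lambda>\<^sub>i\<close> depends on \<open>a + b\<close> only. At each point the extra terms are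
  removed by a unitriangular change of basis.
\<close>

section \<open>Smooth functions closed under differentiation\<close>

text \<open>This supplies the set of functions closed under partial derivatives that
  \<open>Cinf_on\<close> asks for. Rule \<open>cong\<close> identifies functions agreeing on
  \<open>U\<close>: derivative formulas hold on \<open>U\<close> only, while \<open>Cinf_on\<close>
  speaks of the total functions \<open>partial_at g i\<close>.\<close>

inductive_set fun_algebra :: "(real^'n) set \<Rightarrow> (real^'n \<Rightarrow> real) set \<Rightarrow> (real^'n \<Rightarrow> real) set"
  for U :: "(real^'n) set" and G :: "(real^'n \<Rightarrow> real) set" where
  gen: "g \<in> G \<Longrightarrow> g \<in> fun_algebra U G"
| const: "(\<lambda>x. c) \<in> fun_algebra U G"
| coord: "(\<lambda>x. x $ i) \<in> fun_algebra U G"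
| add: "f \<in> fun_algebra U G \<Longrightarrow> g \<in> fun_algebra U G \<Longrightarrow> (\<lambda>x. f x + g x) \<in> fun_algebra U G"
| mult: "f \<in> fun_algebra U G \<Longrightarrow> g \<in> fun_algebra U G \<Longrightarrow> (\<lambda>x. f x * g x) \<in> fun_algebra U G"
| cong: "f \<in> fun_algebra U G \<Longrightarrow> (\<And>x. x \<in> U \<Longrightarrow> g x = f x) \<Longrightarrow> g \<in> fun_algebra U G"

lemma fun_algebra_sum:
  "(\<And>i. i \<in> I \<Longrightarrow> f i \<in> fun_algebra U G) \<Longrightarrow> (\<lambda>x. \<Sum>i\<in>I. f i x) \<in> fun_algebra U G"
  by (induction I rule: infinite_finite_induct) (auto intro: fun_algebra.intros)

lemma fun_algebra_power: "f \<in> fun_algebra U G \<Longrightarrow> (\<lambda>x. f x ^ m) \<in> fun_algebra U G"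
  by (induction m) (auto intro: fun_algebra.intros)

lemma partial_at_eq: "(f has_derivative f') (at x) \<Longrightarrow> partial_at f i x = f' (axis i 1)"
  unfolding partial_at_def using frechet_derivative_at by metis

lemma partial_at_cong:
  assumes "open U" "x \<in> U" "\<And>y. y \<in> U \<Longrightarrow> g y = f y" "f differentiable (at x)"
  shows "g differentiable (at x)" "partial_at g i x = partial_at f i x"
proof -
  from assms(4) have 1: "(f has_derivative frechet_derivative f (at x)) (at x)"
    by (simp add: frechet_derivative_works)
  then have 2: "(g has_derivative frechet_derivative f (at x)) (at x)"
    using has_derivative_transform_within_open[OF 1 assms(1,2)] assms(3) by metis
  show "g differentiable (at x)" using 2 differentiable_def by blast
  show "partial_at g i x = partial_at f i x" using partial_at_eq[OF 2] partial_at_def by metis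
qed

text \<open>By the sum and Leibniz rules it suffices to know the generators. In the
  \<open>cong\<close> case openness of \<open>U\<close> lets values on \<open>U\<close> determine
  the derivatives there.\<close>

lemma fun_algebra_partial:
  assumes U: "open U"
    and G: "\<And>g. g \<in> G \<Longrightarrow> (\<forall>x\<in>U. g differentiable (at x)) \<and> (\<forall>i. partial_at g i \<in> fun_algebra U G)"
    and f: "f \<in> fun_algebra U G"
  shows "(\<forall>x\<in>U. f differentiable (at x)) \<and> (\<forall>i. partial_at f i \<in> fun_algebra U G)"
  using f
proof induction
  case (gen g)
  then show ?case using G by blast
next
  case (const c)
  have "partial_at (\<lambda>x. c) i x = 0" for i :: 'a and x by (rule partial_at_eq) simp
  then show ?case by (auto intro: fun_algebra.const fun_algebra.cong[OF fun_algebra.const])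
next
  case (coord j)
  have d: "((\<lambda>x. x $ j) has_derivative (\<lambda>v. v $ j)) (at x)" for x :: "real^'a"
    by (simp add: bounded_linear_imp_has_derivative bounded_linear_vec_nth)
  then have "partial_at (\<lambda>x. x $ j) i x = axis i 1 $ j" for i :: 'a and x by (rule partial_at_eq)
  then show ?case using d
    by (auto intro: fun_algebra.coord fun_algebra.cong[OF fun_algebra.const] simp: differentiable_def)
next
  case (add f g)
  have d: "((\<lambda>x. f x + g x) has_derivative (\<lambda>v. frechet_derivative f (at x) v + frechet_derivative g (at x) v)) (at x)"
    if "x \<in> U" for x
    using add that by (intro has_derivative_add) (auto simp: frechet_derivative_works)
  have p: "partial_at (\<lambda>x. f x + g x) i x = partial_at f i x + partial_at g i x" if "x \<in> U" for i x
    using partial_at_eq[OF d[OF that]] by (simp add: partial_at_def)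
  have m: "(\<lambda>x. partial_at f i x + partial_at g i x) \<in> fun_algebra U G" for i
    using add by (intro fun_algebra.add) auto
  have "partial_at (\<lambda>x. f x + g x) i \<in> fun_algebra U G" for i
    by (rule fun_algebra.cong[OF m p])
  with d add.IH show ?case by (auto intro: fun_algebra.add simp: differentiable_def)
next
  case (mult f g)
  have d: "((\<lambda>x. f x * g x) has_derivative (\<lambda>v. f x * frechet_derivative g (at x) v + frechet_derivative f (at x) v * g x)) (at x)"
    if "x \<in> U" for x
    using mult that by (intro has_derivative_mult) (auto simp: frechet_derivative_works)
  have p: "partial_at (\<lambda>x. f x * g x) i x = f x * partial_at g i x + partial_at f i x * g x" if "x \<in> U" for i x
    using partial_at_eq[OF d[OF that]] by (simp add: partial_at_def)
  have m: "(\<lambda>x. f x * partial_at g i x + partial_at f i x * g x) \<in> fun_algebra U G" for i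
    using mult by (intro fun_algebra.add[OF fun_algebra.mult fun_algebra.mult]) auto
  have "partial_at (\<lambda>x. f x * g x) i \<in> fun_algebra U G" for i
    by (rule fun_algebra.cong[OF m p])
  with d mult.IH show ?case by (auto intro: fun_algebra.mult simp: differentiable_def)
next
  case (cong f g)
  have p: "partial_at g i x = partial_at f i x" if "x \<in> U" for i x
    using cong that by (intro partial_at_cong(2)[OF U]) auto
  have d: "g differentiable (at x)" if "x \<in> U" for x
    using cong that by (intro partial_at_cong(1)[OF U, of x g f]) auto
  have "partial_at g i \<in> fun_algebra U G" for i
    by (rule fun_algebra.cong[of "partial_at f i", OF _ p]) (use cong in auto)
  moreover have "g \<in> fun_algebra U G"
    by (rule fun_algebra.cong[of f]) (use cong in auto)
  ultimately show ?case using d by blast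
qed

lemma fun_algebra_Cinf:
  assumes "open U"
    and "\<And>g. g \<in> G \<Longrightarrow> (\<forall>x\<in>U. g differentiable (at x)) \<and> (\<forall>i. partial_at g i \<in> fun_algebra U G)"
    and "f \<in> fun_algebra U G"
  shows "Cinf_on U f"
  unfolding Cinf_on_def using fun_algebra_partial[OF assms(1,2)] assms(3)
  by (intro exI[of _ "fun_algebra U G"]) auto

section \<open>Eigenvalues defined by an implicit equation\<close>

text \<open>The equation \<open>l = c + (\<Sum>j\<le>K. y\<^sub>j l\<^bsup>K-j\<^esup>)\<close> is solved near \<open>y = 0\<close>: it says that \<open>l\<close>
  is the coordinate \<open>Y K\<close> of the preimage under the map below.\<close>

lemma implicit_eigenvalue_exists:
  fixes Y :: "nat \<Rightarrow> 'n::finite" and c :: real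
  assumes inj: "inj_on Y {..K}"
  obtains V l where "open V" "(0::real^'n) \<in> V" "\<And>x. x \<in> V \<Longrightarrow> l differentiable (at x)"
    "\<And>x. x \<in> V \<Longrightarrow> l x = c + (\<Sum>j\<le>K. x $ Y j * l x ^ (K - j))"
    "\<And>x. x \<in> V \<Longrightarrow> \<bar>l x - c\<bar> < 1/2"
proof -
  define T where "T j = Blinfun (\<lambda>v::real^'n. axis (Y K) (v $ Y j))" for j
  have bl: "bounded_linear (\<lambda>v::real^'n. axis (Y K) (v $ Y j) :: real^'n)" for j
  proof -
    have "(\<lambda>v::real^'n. axis (Y K) (v $ Y j) :: real^'n) = (\<lambda>v. (v $ Y j) *\<^sub>R axis (Y K) 1)"
      by (auto simp: axis_def vec_eq_iff)
    then show ?thesis by (simp add: bounded_linear_vec_nth bounded_linear_scaleR_const)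
  qed
  have T: "blinfun_apply (T j) v = axis (Y K) (v $ Y j)" for j v
    unfolding T_def using bl by (simp add: bounded_linear_Blinfun_apply)
  have nY: "Y j \<noteq> Y K" if "j < K" for j
    using inj that by (metis atMost_iff inj_onD less_imp_le nat_neq_iff order_refl)
  \<comment> \<open>Coordinate \<open>Y K\<close> of \<open>z\<close> holds the unknown
    \<open>l\<close>. The map replaces it by the value of \<open>y_K\<close> for which the equation
    holds, solvable because \<open>y_K\<close> enters with factor \<open>l ^ 0\<close>. A local
    inverse of \<open>f\<close> therefore reads off \<open>l\<close>.\<close>
  define f where "f z = z + axis (Y K) (- c - (\<Sum>j<K. z $ Y j * z $ Y K ^ (K - j)))" for z :: "real^'n"
  define f' where "f' z = id_blinfun - (\<Sum>j<K. (z $ Y K ^ (K - j)) *\<^sub>R T j +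
      (z $ Y j * (real (K - j) * z $ Y K ^ (K - j - 1))) *\<^sub>R T K)" for z :: "real^'n"
  have cf: "continuous_on UU f'" for UU unfolding f'_def by (intro continuous_intros)
  have fal: "f z = z + (- c - (\<Sum>j<K. z $ Y j * z $ Y K ^ (K - j))) *\<^sub>R axis (Y K) 1" for z
    by (auto simp: f_def axis_def vec_eq_iff)
  have dn: "((\<lambda>z::real^'n. z $ i) has_derivative (\<lambda>v. v $ i)) (at z)" for i z
    by (simp add: bounded_linear_imp_has_derivative bounded_linear_vec_nth)
  have df: "(f has_derivative blinfun_apply (f' z)) (at z)" for z
    unfolding fal[abs_def]
    by (rule derivative_eq_intros dn refl)+
       (auto simp: f'_def T vec_eq_iff axis_def blinfun.diff_left blinfun.sum_left blinfun.add_left blinfun.scaleR_left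
         sum.distrib algebra_simps intro!: ext sum.cong)
  define z0 where "z0 = (axis (Y K) c :: real^'n)"
  have z0: "z0 $ Y K = c" "j < K \<Longrightarrow> z0 $ Y j = 0" for j using nY by (auto simp: z0_def axis_def)
  \<comment> \<open>At \<open>z0\<close> the derivative is the identity minus a square-zero map:
    each \<open>T j\<close> with \<open>j < K\<close> reads coordinate \<open>Y j\<close> and writes
    only to \<open>Y K\<close>. Changing the sign gives the inverse.\<close>
  define inv0 where "inv0 = id_blinfun + (\<Sum>j<K. (c ^ (K - j)) *\<^sub>R T j)"
  have f0: "f' z0 = id_blinfun - (\<Sum>j<K. (c ^ (K - j)) *\<^sub>R T j)"
    unfolding f'_def by (intro arg_cong2[where f = minus] refl sum.cong) (auto simp: z0)
  have inv: "inv0 o\<^sub>L f' z0 = id_blinfun"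
    by (rule blinfun_eqI) (auto simp: f0 inv0_def T blinfun.diff_left blinfun.sum_left
        blinfun.add_left blinfun.scaleR_left blinfun.diff_right blinfun.sum_right sum.distrib
        axis_def vec_eq_iff nY algebra_simps)
  define V0 where "V0 = {z::real^'n. \<bar>z $ Y K - c\<bar> < 1/2}"
  have V0: "open V0" unfolding V0_def
    by (intro open_Collect_less continuous_intros)
  have z0V: "z0 \<in> V0" by (simp add: V0_def z0)
  obtain U' V g g' where o: "open U'" "U' \<subseteq> V0" "z0 \<in> U'" "open V" "f z0 \<in> V"
     "homeomorphism U' V f g" "\<And>y. y \<in> V \<Longrightarrow> (g has_derivative (g' y)) (at y)"
    by (rule inverse_function_theorem[OF V0 df cf z0V inv]) (rule that, assumption+)
  have fz0: "f z0 = 0"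
  proof -
    have "(\<Sum>j<K. z0 $ Y j * z0 $ Y K ^ (K - j)) = 0" using z0 by simp
    then show ?thesis by (auto simp: f_def z0_def axis_def vec_eq_iff)
  qed
  define l where "l x = g x $ Y K" for x
  show thesis
  proof
    show "open V" "0 \<in> V" using o fz0 by auto
    fix x assume x: "x \<in> V"
    have gx: "g x \<in> U'" "f (g x) = x" using o(6) x by (auto simp: homeomorphism_def)
    then show "\<bar>l x - c\<bar> < 1/2" using o(2) by (auto simp: V0_def l_def)
    show "l differentiable (at x)" unfolding l_def differentiable_def
      using has_derivative_compose[OF o(7)[OF x] dn[of "Y K"]] by blast
    have "x $ Y j = g x $ Y j" if "j < K" for j
      using arg_cong[OF gx(2), of "\<lambda>z. z $ Y j"] nY[OF that] by (simp add: f_def axis_def)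
    moreover have "x $ Y K = g x $ Y K - c - (\<Sum>j<K. g x $ Y j * g x $ Y K ^ (K - j))"
      using arg_cong[OF gx(2), of "\<lambda>z. z $ Y K"] by (simp add: f_def axis_def)
    ultimately show "l x = c + (\<Sum>j\<le>K. x $ Y j * l x ^ (K - j))"
      by (simp add: l_def lessThan_Suc_atMost[symmetric])
  qed
qed

locale implicit_eigenvalue =
  fixes Y :: "nat \<Rightarrow> 'n::finite" and K :: nat and c :: real
    and V :: "(real^'n) set" and l :: "real^'n \<Rightarrow> real"
  assumes inj_Y: "inj_on Y {..K}"
    and open_V: "open V"
    and diff_l: "x \<in> V \<Longrightarrow> l differentiable (at x)"
    and l_eq: "x \<in> V \<Longrightarrow> l x = c + (\<Sum>j\<le>K. x $ Y j * l x ^ (K - j))"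
begin

text \<open>The derivative of left side minus right side of the equation with respect to the unknown
  \<open>l\<close>, at fixed coordinates. For \<open>j = K\<close> the factor \<open>real 0\<close>
  neutralises the truncated exponent.\<close>

definition D :: "real^'n \<Rightarrow> real" where
  "D x = 1 - (\<Sum>j\<le>K. x $ Y j * (real (K - j) * l x ^ (K - j - 1)))"

definition W :: "real^'n \<Rightarrow> real" where "W x = inverse (D x)"

text \<open>Minus the derivative of \<open>D\<close> with respect to \<open>l\<close>, at fixed
  coordinates.\<close>

definition Z :: "real^'n \<Rightarrow> real" where
  "Z x = (\<Sum>j\<le>K. x $ Y j * (real (K - j) * (real (K - j - 1) * l x ^ (K - j - 2))))"

definition G :: "nat \<Rightarrow> real^'n \<Rightarrow> real" where "G m x = l x ^ m * W x"

text \<open>At fixed coordinates this is \<open>W\<close> times the derivative of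
  \<open>l ^ m * W\<close> with respect to \<open>l\<close>.\<close>

definition H :: "nat \<Rightarrow> real^'n \<Rightarrow> real" where
  "H m x = real m * l x ^ (m - 1) * W x ^ 2 + l x ^ m * W x ^ 3 * Z x"

lemma has_derivative_nth: "((\<lambda>z::real^'n. z $ i) has_derivative (\<lambda>v. v $ i)) (at z)"
  by (simp add: bounded_linear_imp_has_derivative bounded_linear_vec_nth)

text \<open>Differentiating the equation gives \<open>D x * l' v\<close> equal to the sum of
  \<open>v $ Y j * l x ^ (K - j)\<close>. In direction \<open>Y K\<close> this sum is 1, so
  \<open>D x\<close> cannot vanish, and division by it yields \<open>l'\<close>.\<close>

lemma
  assumes x: "x \<in> V"
  shows D_nonzero: "D x \<noteq> 0"
    and l_has_derivative: "(l has_derivative (\<lambda>v. \<Sum>j\<le>K. v $ Y j * G (K - j) x)) (at x)"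
proof -
  define l' where "l' = frechet_derivative l (at x)"
  have l': "(l has_derivative l') (at x)"
    using diff_l[OF x] by (simp add: l'_def frechet_derivative_works)
  have "((\<lambda>x. c + (\<Sum>j\<le>K. x $ Y j * l x ^ (K - j))) has_derivative
      (\<lambda>v. \<Sum>j\<le>K. x $ Y j * (real (K - j) * l' v * l x ^ (K - j - 1)) + v $ Y j * l x ^ (K - j))) (at x)"
    by (rule derivative_eq_intros has_derivative_nth l' refl)+ simp
  then have "(l has_derivative
      (\<lambda>v. \<Sum>j\<le>K. x $ Y j * (real (K - j) * l' v * l x ^ (K - j - 1)) + v $ Y j * l x ^ (K - j))) (at x)"
    by (rule has_derivative_transform_within_open[OF _ open_V x]) (simp add: l_eq[symmetric])
  from has_derivative_unique[OF l' this]
  have "l' v = (\<Sum>j\<le>K. x $ Y j * (real (K - j) * l' v * l x ^ (K - j - 1)) + v $ Y j * l x ^ (K - j))" for v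
    by metis
  then have *: "D x * l' v = (\<Sum>j\<le>K. v $ Y j * l x ^ (K - j))" for v
    unfolding D_def left_diff_distrib sum_distrib_right
    by (simp add: sum.distrib ac_simps del: of_nat_diff) (metis (no_types, lifting) add_diff_cancel_right')
  have "(\<Sum>j\<le>K. axis (Y K) 1 $ Y j * l x ^ (K - j)) = (\<Sum>j\<le>K. if j = K then 1 else 0)"
    using inj_Y by (intro sum.cong) (auto simp: axis_def inj_on_eq_iff)
  with *[of "axis (Y K) 1"] show D: "D x \<noteq> 0" by auto
  have "l' v = (\<Sum>j\<le>K. v $ Y j * G (K - j) x)" for v
  proof -
    have "l' v = W x * (D x * l' v)" using D by (simp add: W_def)
    then show ?thesis unfolding * by (simp add: G_def sum_distrib_left algebra_simps)
  qed
  then show "(l has_derivative (\<lambda>v. \<Sum>j\<le>K. v $ Y j * G (K - j) x)) (at x)"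
    by (intro has_derivative_eq_rhs[OF l'] ext)
qed

lemma W_has_derivative:
  assumes x: "x \<in> V"
  shows "(W has_derivative (\<lambda>v. \<Sum>j\<le>K. v $ Y j * H (K - j) x)) (at x)"
proof -
  let ?l' = "\<lambda>v. \<Sum>j\<le>K. v $ Y j * G (K - j) x"
  have "(D has_derivative (\<lambda>v. - (\<Sum>j\<le>K. x $ Y j * (real (K - j) * (real (K - j - 1) * ?l' v * l x ^ (K - j - 1 - 1)))
       + v $ Y j * (real (K - j) * l x ^ (K - j - 1))))) (at x)"
    unfolding D_def[abs_def]
    by (rule derivative_eq_intros has_derivative_nth l_has_derivative[OF x] refl)+ simp
  then have d: "(W has_derivative (\<lambda>v. - (inverse (D x) * (- (\<Sum>j\<le>K. x $ Y j * (real (K - j) * (real (K - j - 1) * ?l' v * l x ^ (K - j - 1 - 1)))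
       + v $ Y j * (real (K - j) * l x ^ (K - j - 1)))) * inverse (D x)))) (at x)"
    unfolding W_def[abs_def] by (rule Deriv.has_derivative_inverse[where f = D, OF D_nonzero[OF x]])
  have "- (inverse (D x) * (- (\<Sum>j\<le>K. x $ Y j * (real (K - j) * (real (K - j - 1) * ?l' v * l x ^ (K - j - 1 - 1)))
       + v $ Y j * (real (K - j) * l x ^ (K - j - 1)))) * inverse (D x)) = (\<Sum>j\<le>K. v $ Y j * H (K - j) x)" for v
  proof -
    have z: "(\<Sum>j\<le>K. x $ Y j * (real (K - j) * (real (K - j - 1) * u * l x ^ (K - j - 1 - 1)))) = u * Z x" for u
      unfolding Z_def sum_distrib_left by (intro sum.cong) (auto simp: numeral_2_eq_2 ac_simps simp del: of_nat_diff)
    show ?thesis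
      unfolding sum.distrib z
      by (simp add: sum.distrib W_def[symmetric] H_def G_def sum_distrib_left sum_distrib_right
          power2_eq_square power3_eq_cube distrib_left distrib_right right_diff_distrib ac_simps del: of_nat_diff)
  qed
  then show ?thesis by (intro has_derivative_eq_rhs[OF d] ext)
qed

text \<open>The first derivatives of \<open>l\<close> are the \<open>G (K - a)\<close>, so the
  second derivative along \<open>Y a\<close> and \<open>Y b\<close> is
  \<open>H ((K - a) + (K - b))\<close>. It depends on \<open>a + b\<close> only, which the Jacobi
  identity for two \<open>X\<close> and one Jordan coordinate needs.\<close>

lemma G_has_derivative:
  assumes x: "x \<in> V"
  shows "(G m has_derivative (\<lambda>v. \<Sum>j\<le>K. v $ Y j * H (m + (K - j)) x)) (at x)"
proof -
  have d: "(G m has_derivative (\<lambda>v. l x ^ m * (\<Sum>j\<le>K. v $ Y j * H (K - j) x) +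
      real m * (\<Sum>j\<le>K. v $ Y j * G (K - j) x) * l x ^ (m - 1) * W x)) (at x)"
    unfolding G_def[abs_def]
    by (rule derivative_eq_intros l_has_derivative[OF x, unfolded G_def] W_has_derivative[OF x] refl)+
  have "l x ^ m * H i x + real m * G i x * l x ^ (m - 1) * W x = H (m + i) x" for i
    by (cases m; cases i) (auto simp: H_def G_def power_add power2_eq_square power3_eq_cube algebra_simps)
  then have "l x ^ m * (v * H i x) + real m * (v * G i x) * l x ^ (m - 1) * W x = v * H (m + i) x" for i v
    by (metis (no_types, opaque_lifting) distrib_left mult.assoc mult.left_commute)
  then have "l x ^ m * (\<Sum>j\<le>K. v $ Y j * H (K - j) x) +
      real m * (\<Sum>j\<le>K. v $ Y j * G (K - j) x) * l x ^ (m - 1) * W x = (\<Sum>j\<le>K. v $ Y j * H (m + (K - j)) x)" for v :: "real^'n"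
    unfolding sum_distrib_left sum_distrib_right sum.distrib[symmetric] by simp
  then show ?thesis by (intro has_derivative_eq_rhs[OF d] ext)
qed

lemma sum_axis_Y: "(\<Sum>j\<le>K. axis i 1 $ Y j * f j) = (\<Sum>j\<le>K. if Y j = i then f j else (0::real))"
  by (intro sum.cong) (auto simp: axis_def)

lemma sum_delta_Y: "j \<le> K \<Longrightarrow> (\<Sum>j'\<le>K. if Y j' = Y j then f j' else (0::real)) = f j"
proof -
  assume j: "j \<le> K"
  then have "(\<Sum>j'\<le>K. if Y j' = Y j then f j' else (0::real)) = (\<Sum>j'\<le>K. if j' = j then f j' else 0)"
    using inj_Y by (intro sum.cong) (auto simp: inj_on_eq_iff)
  then show ?thesis using j by simp
qed

lemma fun_algebra_G:
  "l \<in> fun_algebra U F \<Longrightarrow> W \<in> fun_algebra U F \<Longrightarrow> G m \<in> fun_algebra U F"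
  unfolding G_def[abs_def] by (intro fun_algebra.mult fun_algebra_power)

lemma fun_algebra_partial_l:
  assumes "l \<in> fun_algebra U F" "W \<in> fun_algebra U F" "U \<subseteq> V"
  shows "partial_at l i \<in> fun_algebra U F"
proof (rule fun_algebra.cong)
  show "(\<lambda>x. \<Sum>j\<le>K. axis i 1 $ Y j * G (K - j) x) \<in> fun_algebra U F"
    using assms by (intro fun_algebra_sum fun_algebra.mult fun_algebra.const fun_algebra_G)
  show "partial_at l i x = (\<Sum>j\<le>K. axis i 1 $ Y j * G (K - j) x)" if "x \<in> U" for x
    using partial_at_eq[OF l_has_derivative] that assms by auto
qed

lemma fun_algebra_partial_W:
  assumes "l \<in> fun_algebra U F" "W \<in> fun_algebra U F" "U \<subseteq> V"
  shows "partial_at W i \<in> fun_algebra U F"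
proof (rule fun_algebra.cong)
  show "(\<lambda>x. \<Sum>j\<le>K. axis i 1 $ Y j * H (K - j) x) \<in> fun_algebra U F"
    unfolding H_def Z_def using assms
    by (intro fun_algebra_sum fun_algebra.mult fun_algebra.add fun_algebra.const fun_algebra.coord fun_algebra_power)
  show "partial_at W i x = (\<Sum>j\<le>K. axis i 1 $ Y j * H (K - j) x)" if "x \<in> U" for x
    using partial_at_eq[OF W_has_derivative] that assms by auto
qed

text \<open>The partial derivative along \<open>Y K\<close> is \<open>G 0\<close>, the reciprocal of
  \<open>D\<close>.\<close>

lemma frechet_derivative_l_nonzero:
  assumes x: "x \<in> V"
  shows "frechet_derivative l (at x) \<noteq> (\<lambda>v. 0)"
proof
  assume "frechet_derivative l (at x) = (\<lambda>v. 0)"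
  then have "partial_at l (Y K) x = 0" by (simp add: partial_at_def)
  with partial_at_eq[OF l_has_derivative[OF x], of "Y K"] have "G 0 x = 0"
    by (simp add: sum_axis_Y sum_delta_Y)
  with D_nonzero[OF x] show False by (simp add: G_def W_def)
qed

end

section \<open>Decoupling a Kronecker block\<close>

definition bilin :: "'f::comm_semiring_1^'n^'n \<Rightarrow> 'f^'n \<Rightarrow> 'f^'n \<Rightarrow> 'f" where
  "bilin A u v = (\<Sum>i\<in>UNIV. \<Sum>j\<in>UNIV. u $ i * A $ i $ j * v $ j)"

lemma bilin_add_left: "bilin A (u + u') v = bilin A u v + bilin A u' v"
  by (simp add: bilin_def algebra_simps sum.distrib)
lemma bilin_add_right: "bilin A u (v + v') = bilin A u v + bilin A u v'"
  by (simp add: bilin_def algebra_simps sum.distrib)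
lemma bilin_scale_left: "bilin A (c *s u) v = c * bilin A u v"
  by (simp add: bilin_def algebra_simps sum_distrib_left)
lemma bilin_scale_right: "bilin A u (c *s v) = c * bilin A u v"
  by (simp add: bilin_def algebra_simps sum_distrib_left)
lemma bilin_sum_left: "bilin A (\<Sum>i\<in>I. f i) v = (\<Sum>i\<in>I. bilin A (f i) v)"
  by (induction I rule: infinite_finite_induct) (auto simp: bilin_add_left, simp_all add: bilin_def)
lemma bilin_sum_right: "bilin A u (\<Sum>i\<in>I. f i) = (\<Sum>i\<in>I. bilin A u (f i))"
  by (induction I rule: infinite_finite_induct) (auto simp: bilin_add_right, simp_all add: bilin_def)
lemma bilin_axis: "bilin A (axis i 1) (axis j 1) = A $ i $ j"
proof -
  have "bilin A (axis i 1) (axis j 1) = (\<Sum>a\<in>UNIV. if a = i then (\<Sum>b\<in>UNIV. if b = j then A $ a $ b else 0) else 0)"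
    unfolding bilin_def axis_def by (intro sum.cong refl) (auto simp: if_distrib cong: if_cong)
  then show ?thesis by simp
qed
lemmas bilin_simps = bilin_add_left bilin_add_right bilin_scale_left bilin_scale_right
  bilin_sum_left bilin_sum_right bilin_axis

lemma congruence_entry:
  "(transpose (\<chi> i a. w a $ i) ** A ** (\<chi> i a. w a $ i)) $ a $ b = bilin A (w a) (w b)"
proof -
  have "(transpose (\<chi> i a. w a $ i) ** A ** (\<chi> i a. w a $ i)) $ a $ b =
    (\<Sum>j\<in>UNIV. \<Sum>i\<in>UNIV. w a $ i * A $ i $ j * w b $ j)"
    by (simp add: matrix_matrix_mult_def transpose_def sum_distrib_right)
  also have "\<dots> = bilin A (w a) (w b)" unfolding bilin_def by (rule sum.swap)
  finally show ?thesis .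
qed

text \<open>The first condition determines the entries above the diagonal from those below. The
  second then links \<open>(i, j + 1)\<close> with \<open>(i + 1, j)\<close> on one antidiagonal, so
  the lower part follows column by column from column 0, taken to be zero. In an abelian group with
  2-torsion skewness does not force a zero diagonal, hence the separate assumptions.\<close>

lemma Kronecker_skew_pencil:
  fixes D0 D1 :: "nat \<Rightarrow> nat \<Rightarrow> 'a::ab_group_add"
  assumes "\<And>i j. D0 i j = - D0 j i" "\<And>i j. D1 i j = - D1 j i" "\<And>i. D0 i i = 0" "\<And>i. D1 i i = 0"
  obtains c where "\<And>i j. c i j - c j i = D0 i j" "\<And>i j. c i (Suc j) - c j (Suc i) = D1 i j"
proof -
  define g where "g = rec_nat (\<lambda>i. 0) (\<lambda>j h i. h (Suc i) - D0 (Suc i) j + D1 i j)"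
  have g: "g (Suc j) i = g j (Suc i) - D0 (Suc i) j + D1 i j" for i j by (simp add: g_def)
  define c where "c i j = (if j \<le> i then g j i else g i j - D0 j i)" for i j
  have "c i j - c j i = D0 i j" for i j
    using assms(1)[of i j] assms(3)[of i] by (cases i j rule: linorder_cases) (auto simp: c_def)
  moreover have *: "c i (Suc j) - c j (Suc i) = D1 i j" if "j < i" for i j
    using that by (auto simp: c_def g)
  have "c i (Suc j) - c j (Suc i) = D1 i j" for i j
    using assms(2)[of i j] assms(4)[of i] *[of i j] *[of j i]
    by (cases i j rule: linorder_cases) (auto, metis minus_diff_eq)
  ultimately show thesis using that by blast
qed

text \<open>Row \<open>i\<close> of \<open>C *v z = 0\<close> involves \<open>z $ i\<close> and
  entries of smaller rank only, so the kernel is trivial by induction on the rank.\<close>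

lemma unitriangular_invertible:
  fixes C :: "'f::field^'n^'n" and rk :: "'n \<Rightarrow> nat"
  assumes one: "\<And>i. C $ i $ i = 1" and tri: "\<And>i a. a \<noteq> i \<Longrightarrow> C $ i $ a \<noteq> 0 \<Longrightarrow> rk a < rk i"
  shows "invertible C"
proof -
  have "z = 0" if z: "C *v z = 0" for z
  proof -
    have "z $ i = 0" for i
    proof (induction "rk i" arbitrary: i rule: less_induct)
      case less
      have "0 = (\<Sum>a\<in>UNIV. C $ i $ a * z $ a)"
        using arg_cong[OF z, of "\<lambda>v. v $ i"] by (simp add: matrix_vector_mult_def)
      also have "\<dots> = (\<Sum>a\<in>UNIV. if a = i then z $ a else 0)"
        using less tri one by (intro sum.cong) auto
      finally show ?case by simp
    qed
    then show ?thesis by (simp add: vec_eq_iff)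
  qed
  then show ?thesis by (simp add: invertible_left_inverse matrix_left_invertible_ker)
qed

text \<open>\<open>X r\<close> and \<open>Y j\<close> index the coordinates of a Kronecker block, \<open>S\<close> those of a nondegenerate part.\<close>

locale Kronecker_split =
  fixes X Y :: "nat \<Rightarrow> 'n::finite" and K :: nat and S :: "'n set"
  assumes inj_X: "inj_on X {..<K}" and inj_Y: "inj_on Y {..K}"
    and XY: "\<And>r j. r < K \<Longrightarrow> j \<le> K \<Longrightarrow> X r \<noteq> Y j"
    and XS: "\<And>r. r < K \<Longrightarrow> X r \<notin> S"
    and YS: "\<And>j. j \<le> K \<Longrightarrow> Y j \<notin> S"
begin

text \<open>The coefficients \<open>f\<close> and \<open>b\<close> cancel the entries between
  \<open>X\<close> and \<open>S\<close>: \<open>f\<close> through the form on \<open>S\<close>,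
  \<open>b\<close> through the pairing of \<open>X\<close> with \<open>Y\<close>. The coefficients
  \<open>c\<close> repair the \<open>X\<close>-\<open>X\<close> entries that \<open>f\<close>
  disturbs.\<close>

definition new_basis :: "(nat \<Rightarrow> 'n \<Rightarrow> 'f::field) \<Rightarrow> (nat \<Rightarrow> 'n \<Rightarrow> 'f) \<Rightarrow> (nat \<Rightarrow> nat \<Rightarrow> 'f) \<Rightarrow> 'n \<Rightarrow> 'f^'n" where
  "new_basis f b c v = axis v 1 +
     (if v \<in> X ` {..<K} then
        (\<Sum>a\<in>S. f (inv_into {..<K} X v) a *s axis a 1) + (\<Sum>j\<le>K. c (inv_into {..<K} X v) j *s axis (Y j) 1)
      else if v \<in> S then \<Sum>j\<le>K. b j v *s axis (Y j) 1 else 0)"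

lemma new_basis_X: "r < K \<Longrightarrow> new_basis f b c (X r) = axis (X r) 1 +
    (\<Sum>a\<in>S. f r a *s axis a 1) + (\<Sum>j\<le>K. c r j *s axis (Y j) 1)"
  using inj_X by (simp add: new_basis_def inv_into_f_f)

lemma new_basis_S: "a \<in> S \<Longrightarrow> new_basis f b c a = axis a 1 + (\<Sum>j\<le>K. b j a *s axis (Y j) 1)"
  using XS by (auto simp: new_basis_def)

lemma new_basis_other: "v \<notin> X ` {..<K} \<Longrightarrow> v \<notin> S \<Longrightarrow> new_basis f b c v = axis v 1"
  by (auto simp: new_basis_def)

lemma invertible_new_basis:
  fixes f :: "nat \<Rightarrow> 'n \<Rightarrow> 'f::field"
  shows "invertible (\<chi> i a. new_basis f b c a $ i)"
proof (rule unitriangular_invertible)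
  fix i a
  have n: "(\<Sum>b\<in>J. g b *s axis (h b) 1) $ i = 0" if "i \<notin> h ` J" for J and g :: "_ \<Rightarrow> 'f" and h :: "_ \<Rightarrow> 'n"
    using that by (auto simp: axis_def intro!: sum.neutral)
  have ax: "axis a (1::'f) $ i = (if a = i then 1 else 0)" for a :: 'n by (simp add: axis_def)
  have S: "a \<in> S \<Longrightarrow> a \<notin> X ` {..<K} \<and> a \<notin> Y ` {..K}" and X: "a \<in> X ` {..<K} \<Longrightarrow> a \<notin> Y ` {..K}" for a
    using XS YS XY by auto
  \<comment> \<open>Corrections go from \<open>X\<close> to \<open>S\<close> and \<open>Y\<close>,
    and from \<open>S\<close> to \<open>Y\<close>; the rank increases along them.\<close>
  let ?rk = "\<lambda>v. if v \<in> X ` {..<K} then 0 else if v \<in> S then 1 else 2::nat"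
  show "(\<chi> i a. new_basis f b c a $ i) $ i $ i = 1"
    using S[of i] X[of i] n[of "\<lambda>x. x" S] n[of Y "{..K}"]
    by (auto simp: new_basis_def ax simp del: sum_component)
  assume "a \<noteq> i" "(\<chi> i a. new_basis f b c a $ i) $ i $ a \<noteq> 0"
  then show "?rk a < ?rk i"
    using S[of i] X[of i] S[of a] X[of a] n[of "\<lambda>x. x" S] n[of Y "{..K}"]
    by (auto simp: new_basis_def ax simp del: sum_component split: if_splits)
qed

text \<open>One computation serves both forms: \<open>X r\<close> is paired with
  \<open>Y (r + \<delta>)\<close>, where \<delta> is 0 for \<open>A\<close> and 1 for
  \<open>B\<close>. Condition \<open>fb\<close> is the vanishing of the new
  \<open>X\<close>-\<open>S\<close> entries and \<open>c\<close> that of the new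
  \<open>X\<close>-\<open>X\<close> entries. The other entries survive because \<open>Y\<close>
  pairs with \<open>X\<close> only.\<close>

lemma congruence_new_basis:
  fixes P P0 :: "'f::field^'n^'n" and \<delta> :: nat
  assumes "\<delta> \<le> 1"
    and skew: "\<And>a b. P $ a $ b = - P $ b $ a" and skew0: "\<And>a b. P0 $ a $ b = - P0 $ b $ a"
    and S0: "\<And>a v. a \<in> S \<Longrightarrow> v \<notin> S \<Longrightarrow> P0 $ a $ v = 0"
    and X0: "\<And>r v. r < K \<Longrightarrow> P0 $ X r $ v = (if v = Y (r + \<delta>) then 1 else 0)"
    and Y0: "\<And>j v. j \<le> K \<Longrightarrow> v \<notin> X ` {..<K} \<Longrightarrow> P0 $ Y j $ v = 0"
    and M: "\<And>r a. r < K \<Longrightarrow> a \<in> S \<Longrightarrow> P $ X r $ a = M r a"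
    and P: "\<And>u v. \<not> (u \<in> X ` {..<K} \<and> v \<in> S) \<Longrightarrow> \<not> (v \<in> X ` {..<K} \<and> u \<in> S) \<Longrightarrow> P $ u $ v = P0 $ u $ v"
    and fb: "\<And>r a. r < K \<Longrightarrow> a \<in> S \<Longrightarrow> M r a + b (r + \<delta>) a + (\<Sum>a'\<in>S. f r a' * P0 $ a' $ a) = 0"
    and c: "\<And>r s. r < K \<Longrightarrow> s < K \<Longrightarrow> c r (s + \<delta>) - c s (r + \<delta>) =
        (\<Sum>a\<in>S. M r a * f s a - f r a * M s a) + (\<Sum>a\<in>S. \<Sum>a'\<in>S. f r a * P0 $ a $ a' * f s a')"
  shows "transpose (\<chi> i a. new_basis f b c a $ i) ** P ** (\<chi> i a. new_basis f b c a $ i) = P0"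
proof -
  have SX: "a \<notin> X ` {..<K}" if "a \<in> S" for a using XS that by auto
  have YX: "Y j \<notin> X ` {..<K}" if "j \<le> K" for j using XY[OF _ that] by (metis image_iff lessThan_iff)
  have XX': "P $ X r $ X s = 0" if "r < K" "s < K" for r s
    using that \<open>\<delta> \<le> 1\<close> XS XY[of s "r + \<delta>"] by (subst P) (auto simp: X0)
  have SS': "P $ a $ a' = P0 $ a $ a'" if "a \<in> S" "a' \<in> S" for a a' using that SX by (intro P) auto
  have SX': "P $ a $ X r = - M r a" if "a \<in> S" "r < K" for a r using that M skew by metis
  have XY': "P $ X r $ Y j = (if j = r + \<delta> then 1 else 0)" if "r < K" "j \<le> K" for r j
    using that YX YS \<open>\<delta> \<le> 1\<close> inj_onD[OF inj_Y, of j "r + \<delta>"] by (subst P) (auto simp: X0)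
  have YX': "P $ Y j $ X r = (if j = r + \<delta> then -1 else 0)" if "r < K" "j \<le> K" for r j
    using XY'[OF that] skew[of "Y j" "X r"] by auto
  have Y': "P $ Y j $ v = 0" if "j \<le> K" "v \<notin> X ` {..<K}" for j v
    using that YX YS by (subst P) (auto simp: Y0)
  have Y'': "P $ v $ Y j = 0" if "j \<le> K" "v \<notin> X ` {..<K}" for j v
    using Y'[OF that] skew[of v "Y j"] by simp
  have SO': "P $ a $ v = 0" if "a \<in> S" "v \<notin> S" "v \<notin> X ` {..<K}" for a v
    using that SX by (subst P) (auto simp: S0)
  note [simp] = bilin_simps M XX' SS' SX' XY' YX' Y' Y'' SX YX XS YS
  let ?w = "new_basis f b c"
  have pick: "(\<Sum>j\<le>K. g j * (if j = r + \<delta> then u else 0)) = g (r + \<delta>) * u" if "r < K" for g :: "nat \<Rightarrow> 'f" and r u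
    using that \<open>\<delta> \<le> 1\<close> by (simp add: if_distrib[of "\<lambda>x. _ * x"] cong: if_cong)
  have w_axis_X: "bilin P (?w (X r)) (axis (X s) 1) = - (\<Sum>a\<in>S. f r a * M s a) - c r (s + \<delta>)"
    if "r < K" "s < K" for r s
    using that pick[of s "c r" "-1"] by (simp add: new_basis_X sum_negf)
  have w_axis_S: "bilin P (?w (X r)) (axis a 1) = M r a + (\<Sum>a'\<in>S. f r a' * P0 $ a' $ a)"
    if "r < K" "a \<in> S" for r a
    using that by (simp add: new_basis_X)
  have w_axis_Y: "bilin P (?w (X r)) (axis (Y j) 1) = (if j = r + \<delta> then 1 else 0)"
    if "r < K" "j \<le> K" for r j
    using that by (simp add: new_basis_X)
  have XX: "bilin P (?w (X r)) (?w (X s)) = P0 $ X r $ X s" if r: "r < K" and s: "s < K" for r s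
  proof -
    have "X s \<noteq> Y (r + \<delta>)" using XY[of s "r + \<delta>"] r s \<open>\<delta> \<le> 1\<close> by simp
    moreover have "bilin P (?w (X r)) (?w (X s)) = - (\<Sum>a\<in>S. f r a * M s a) - c r (s + \<delta>)
        + (\<Sum>a\<in>S. f s a * (M r a + (\<Sum>a'\<in>S. f r a' * P0 $ a' $ a))) + c s (r + \<delta>)"
      using r s pick[of r "c s" 1] unfolding new_basis_X[OF s]
      by (simp add: bilin_add_right bilin_sum_right bilin_scale_right w_axis_X w_axis_S w_axis_Y)
    moreover have "(\<Sum>a\<in>S. f s a * (\<Sum>a'\<in>S. f r a' * P0 $ a' $ a)) = (\<Sum>a\<in>S. \<Sum>a'\<in>S. f r a * P0 $ a $ a' * f s a')"
      unfolding sum_distrib_left by (subst sum.swap) (simp add: ac_simps)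
    ultimately show ?thesis using c[OF r s] r s
      by (simp add: X0 distrib_left sum.distrib sum_subtractf diff_eq_eq ac_simps)
  qed
  have XS: "bilin P (?w (X r)) (?w a) = P0 $ X r $ a" if r: "r < K" and a: "a \<in> S" for r a
  proof -
    have "bilin P (?w (X r)) (?w a) = M r a + b (r + \<delta>) a + (\<Sum>a'\<in>S. f r a' * P0 $ a' $ a)"
      using r a pick[of r "\<lambda>j. b j a" 1] unfolding new_basis_S[OF a]
      by (simp add: bilin_add_right bilin_sum_right bilin_scale_right w_axis_S w_axis_Y)
    also have "\<dots> = P0 $ X r $ a" using fb[OF r a] r a \<open>\<delta> \<le> 1\<close> YS[of "r + \<delta>"] by (auto simp: X0)
    finally show ?thesis .
  qed
  have XO: "bilin P (?w (X r)) (?w v) = P0 $ X r $ v" if "r < K" "v \<notin> X ` {..<K}" "v \<notin> S" for r v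
    using that P[of "X r" v] SO' by (simp add: new_basis_X new_basis_other)
  have SS: "bilin P (?w a) (?w a') = P0 $ a $ a'" if "a \<in> S" "a' \<in> S" for a a'
    using that by (simp add: new_basis_S)
  have SO: "bilin P (?w a) (?w v) = P0 $ a $ v" if "a \<in> S" "v \<notin> X ` {..<K}" "v \<notin> S" for a v
    using that SO' by (simp add: new_basis_S new_basis_other S0)
  have OO: "bilin P (?w u) (?w v) = P0 $ u $ v"
    if "u \<notin> X ` {..<K}" "u \<notin> S" "v \<notin> X ` {..<K}" "v \<notin> S" for u v
    using that P by (simp add: new_basis_other)
  have sk: "bilin P x y = - bilin P y x" for x y
  proof -
    have "bilin P x y = (\<Sum>j\<in>UNIV. \<Sum>i\<in>UNIV. x $ i * P $ i $ j * y $ j)" unfolding bilin_def by (rule sum.swap)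
    also have "\<dots> = - bilin P y x" unfolding bilin_def sum_negf[symmetric]
      by (intro sum.cong refl) (subst skew, simp add: ac_simps)
    finally show ?thesis .
  qed
  have X: "bilin P (?w u) (?w v) = P0 $ u $ v" if u: "u \<in> X ` {..<K}" for u v
  proof -
    obtain r where r: "r < K" "u = X r" using u by blast
    show ?thesis
    proof (cases "v \<in> X ` {..<K}")
      case True
      then obtain s where "s < K" "v = X s" by blast
      then show ?thesis using XX r by simp
    next
      case False
      then show ?thesis using XS[of r v] XO[of r v] r by blast
    qed
  qed
  have S: "bilin P (?w u) (?w v) = P0 $ u $ v" if "u \<in> S" "v \<notin> X ` {..<K}" for u v
    using that SS SO by blast
  have "bilin P (?w u) (?w v) = P0 $ u $ v" for u v
  proof -
    \<comment> \<open>Each pair of index classes was treated in one order; skewness supplies the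
      other.\<close>
    have "bilin P (?w u) (?w v) = P0 $ u $ v \<or> bilin P (?w v) (?w u) = P0 $ v $ u"
      using X[of u v] X[of v u] S[of u v] S[of v u] OO[of u v] by blast
    then show ?thesis using sk[of "?w u" "?w v"] skew0[of u v] by metis
  qed
  then show ?thesis by (simp add: vec_eq_iff congruence_entry)
qed

text \<open>The vanishing of the coupling of \<open>B\<close> expresses \<open>f\<close> through \<open>b\<close>; that of the coupling of \<open>A\<close>
  then becomes a downward recursion starting from \<open>b K = 0\<close>.\<close>

lemma remove_coupling:
  fixes A A0 B :: "'f::field_char_0^'n^'n"
  assumes skewA: "\<And>a b. A $ a $ b = - A $ b $ a" and skew0: "\<And>a b. A0 $ a $ b = - A0 $ b $ a"
    and skewB: "\<And>a b. B $ a $ b = - B $ b $ a"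
    and S0: "\<And>a v. a \<in> S \<Longrightarrow> v \<notin> S \<Longrightarrow> A0 $ a $ v = 0" "\<And>a v. a \<in> S \<Longrightarrow> v \<notin> S \<Longrightarrow> B $ a $ v = 0"
    and X0: "\<And>r v. r < K \<Longrightarrow> A0 $ X r $ v = (if v = Y r then 1 else 0)"
      "\<And>r v. r < K \<Longrightarrow> B $ X r $ v = (if v = Y (Suc r) then 1 else 0)"
    and Y0: "\<And>j v. j \<le> K \<Longrightarrow> v \<notin> X ` {..<K} \<Longrightarrow> A0 $ Y j $ v = 0"
      "\<And>j v. j \<le> K \<Longrightarrow> v \<notin> X ` {..<K} \<Longrightarrow> B $ Y j $ v = 0"
    and A: "\<And>u v. \<not> (u \<in> X ` {..<K} \<and> v \<in> S) \<Longrightarrow> \<not> (v \<in> X ` {..<K} \<and> u \<in> S) \<Longrightarrow> A $ u $ v = A0 $ u $ v"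
    and BB: "\<And>a b. a \<in> S \<Longrightarrow> b \<in> S \<Longrightarrow> (\<Sum>c\<in>S. B $ a $ c * B $ c $ b) = (if a = b then -1 else 0)"
  obtains C where "invertible C" "transpose C ** A ** C = A0" "transpose C ** B ** C = B"
proof -
  define M where "M r a = A $ X r $ a" for r a
  \<comment> \<open>Right multiplication by \<open>B\<close> on \<open>S\<close>. As
    \<open>B\<close> squares to minus the identity there, \<open>f = F b\<close> solves the equation
    \<open>b + f B = 0\<close> for the form \<open>B\<close>.\<close>
  define F where "F h a = (\<Sum>a'\<in>S. h a' * B $ a' $ a)" for h :: "'n \<Rightarrow> 'f" and a
  \<comment> \<open>The recursion for \<open>b\<close> runs downward, so \<open>\<beta>\<close>
    counts from the top. The equations for \<open>A\<close> constrain \<open>b r\<close> for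
    \<open>r < K\<close> only, which leaves \<open>b K\<close> free to be zero.\<close>
  define \<beta> where "\<beta> = rec_nat (\<lambda>a. 0) (\<lambda>m h a. - M (K - Suc m) a - (\<Sum>a'\<in>S. F h a' * A0 $ a' $ a))"
  define b where "b j = \<beta> (K - j)" for j
  define f where "f r = F (b (Suc r))" for r
  have b: "b r a = - M r a - (\<Sum>a'\<in>S. f r a' * A0 $ a' $ a)" if "r < K" for r a
  proof -
    have "K - r = Suc (K - Suc r)" "K - Suc (K - Suc r) = r" using that by auto
    then show ?thesis by (simp add: b_def f_def \<beta>_def)
  qed
  have FB: "(\<Sum>a'\<in>S. F h a' * B $ a' $ a) = - h a" if "a \<in> S" for h a
  proof -
    have "(\<Sum>a'\<in>S. F h a' * B $ a' $ a) = (\<Sum>a''\<in>S. h a'' * (\<Sum>a'\<in>S. B $ a'' $ a' * B $ a' $ a))"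
      unfolding F_def sum_distrib_left sum_distrib_right by (subst sum.swap) (simp add: mult.assoc)
    also have "\<dots> = (\<Sum>a''\<in>S. if a'' = a then - h a'' else 0)"
      using that BB by (intro sum.cong) auto
    finally show ?thesis using that by simp
  qed
  define Q where "Q P r s = (\<Sum>a\<in>S. \<Sum>a'\<in>S. f r a * P $ a $ a' * f s a')" for P :: "'f^'n^'n" and r s
  define D0 where "D0 r s = (\<Sum>a\<in>S. M r a * f s a - f r a * M s a) + Q A0 r s" for r s
  have Qskew: "Q P r s = - Q P s r" if "\<And>a b. P $ a $ b = - P $ b $ a" for P r s
  proof -
    have "Q P r s = (\<Sum>a'\<in>S. \<Sum>a\<in>S. f r a * P $ a $ a' * f s a')" unfolding Q_def by (rule sum.swap)
    also have "\<dots> = - Q P s r" unfolding Q_def sum_negf[symmetric]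
      by (intro sum.cong refl) (subst that, simp add: ac_simps)
    finally show ?thesis .
  qed
  have self_neg: "x = 0" if "x = - x" for x :: 'f
    using that by (metis add.right_inverse mult_2 mult_eq_0_iff zero_neq_numeral)
  \<comment> \<open>The same \<open>c\<close> must cancel the \<open>X\<close>-\<open>X\<close>
    entries of both forms. Their targets are \<open>D0\<close> for \<open>A\<close> and
    \<open>Q B\<close> for \<open>B\<close>, which has no coupling.\<close>
  obtain c where c: "\<And>i j. c i j - c j i = D0 i j" "\<And>i j. c i (Suc j) - c j (Suc i) = Q B i j"
  proof (rule Kronecker_skew_pencil[of D0 "Q B"])
    show "D0 i j = - D0 j i" for i j
      using Qskew[OF skew0, of i j] by (simp add: D0_def sum_subtractf ac_simps)
    show "D0 i i = 0" for i using self_neg[OF Qskew[OF skew0]] by (simp add: D0_def ac_simps)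
    show "Q B i i = 0" for i by (rule self_neg[OF Qskew[OF skewB]])
    show "Q B i j = - Q B j i" for i j by (rule Qskew[OF skewB])
  qed (rule that)
  show thesis
  proof
    let ?C = "\<chi> i a. new_basis f b c a $ i"
    show "invertible ?C" by (rule invertible_new_basis)
    show "transpose ?C ** A ** ?C = A0"
    proof (rule congruence_new_basis[where \<delta> = 0 and M = M])
      show "M r a + b (r + 0) a + (\<Sum>a'\<in>S. f r a' * A0 $ a' $ a) = 0" if "r < K" for r a
        using b[OF that] by simp
      show "c r (s + 0) - c s (r + 0) = (\<Sum>a\<in>S. M r a * f s a - f r a * M s a) +
          (\<Sum>a\<in>S. \<Sum>a'\<in>S. f r a * A0 $ a $ a' * f s a')" for r s
        using c(1)[of r s] by (simp add: D0_def Q_def)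
      show "A0 $ X r $ v = (if v = Y (r + 0) then 1 else 0)" if "r < K" for r v using X0(1)[OF that] by simp
    qed (fact skewA skew0 S0(1) Y0(1) A | simp add: M_def)+
    show "transpose ?C ** B ** ?C = B"
    proof (rule congruence_new_basis[where \<delta> = 1 and M = "\<lambda>_ _. 0"])
      show "0 + b (r + 1) a + (\<Sum>a'\<in>S. f r a' * B $ a' $ a) = 0" if "a \<in> S" for r a
        using FB[OF that, of "b (Suc r)"] by (simp add: f_def)
      show "c r (s + 1) - c s (r + 1) = (\<Sum>a\<in>S. 0 * f s a - f r a * 0) +
          (\<Sum>a\<in>S. \<Sum>a'\<in>S. f r a * B $ a $ a' * f s a')" for r s
        using c(2)[of r s] by (simp add: Q_def)
      show "B $ X r $ a = 0" if "r < K" "a \<in> S" for r a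
        using that YS[of "Suc r"] by (auto simp: X0)
      show "B $ X r $ v = (if v = Y (r + 1) then 1 else 0)" if "r < K" for r v using X0(2)[OF that] by simp
    qed (fact skewB S0(2) Y0(2) | simp)+
  qed
qed

end

section \<open>The Poisson pencil\<close>

text \<open>\<open>N\<close> is the constant part of \<open>A\<close>, the normal form with all
  Jordan eigenvalues set to 0; \<open>A0\<close> puts them back. Indices outside \<open>S\<close>
  and the ranges of \<open>X\<close> and \<open>Y\<close> are meant for the remaining Kronecker
  blocks.\<close>

locale Kronecker_Jordan_pencil = Kronecker_split X Y K S
  for X Y :: "nat \<Rightarrow> 'n::finite" and K :: nat and S :: "'n set" +
  fixes U :: "(real^'n) set" and I :: "nat set" and c :: "nat \<Rightarrow> real" and lam :: "nat \<Rightarrow> real^'n \<Rightarrow> real"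
    and eig :: "'n \<Rightarrow> nat" and \<omega> :: "'n \<Rightarrow> real" and N B :: "real^'n^'n"
  assumes open_U: "open U"
    and implicit: "i \<in> I \<Longrightarrow> implicit_eigenvalue Y K (c i) U (lam i)"
    and eig: "a \<in> S \<Longrightarrow> eig a \<in> I"
    and skew_N: "N $ a $ b = - N $ b $ a" and skew_B: "B $ a $ b = - B $ b $ a"
    and N_S: "a \<in> S \<Longrightarrow> v \<notin> S \<Longrightarrow> N $ a $ v = 0" and B_S: "a \<in> S \<Longrightarrow> v \<notin> S \<Longrightarrow> B $ a $ v = 0"
    and N_X: "r < K \<Longrightarrow> N $ X r $ v = (if v = Y r then 1 else 0)"
    and B_X: "r < K \<Longrightarrow> B $ X r $ v = (if v = Y (Suc r) then 1 else 0)"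
    and N_Y: "j \<le> K \<Longrightarrow> v \<notin> X ` {..<K} \<Longrightarrow> N $ Y j $ v = 0"
    and B_Y: "j \<le> K \<Longrightarrow> v \<notin> X ` {..<K} \<Longrightarrow> B $ Y j $ v = 0"
    and N_weight: "a \<in> S \<Longrightarrow> b \<in> S \<Longrightarrow> N $ a $ b \<noteq> 0 \<Longrightarrow> eig a = eig b \<and> \<omega> a + \<omega> b = 0"
    and B_weight: "a \<in> S \<Longrightarrow> b \<in> S \<Longrightarrow> B $ a $ b \<noteq> 0 \<Longrightarrow> eig a = eig b \<and> \<omega> a + \<omega> b = 1"
    and B_square: "a \<in> S \<Longrightarrow> b \<in> S \<Longrightarrow> (\<Sum>c\<in>S. B $ a $ c * B $ c $ b) = (if a = b then -1 else 0)"
begin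

text \<open>\<open>g i (K - j)\<close> is the derivative of \<open>lam i\<close> along
  \<open>Y j\<close>, so the exponent \<open>K - Suc r\<close> belongs to
  \<open>Y (Suc r)\<close>.\<close>

abbreviation g where "g i \<equiv> implicit_eigenvalue.G Y K (lam i)"
abbreviation h where "h i \<equiv> implicit_eigenvalue.H Y K (lam i)"
abbreviation ix where "ix \<equiv> inv_into {..<K} X"

definition A0 :: "real^'n \<Rightarrow> real^'n^'n" where
  "A0 x = (\<chi> u v. N $ u $ v + (if u \<in> S \<and> v \<in> S then lam (eig u) x * B $ u $ v else 0))"

text \<open>The Hamiltonian vector fields of the \<open>X r\<close> move the eigenvalues; the coupling makes them
  rescale the Jordan coordinates so that the bivector of the Jordan part is preserved.\<close>

definition coupling :: "real^'n \<Rightarrow> 'n \<Rightarrow> 'n \<Rightarrow> real" where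
  "coupling x u v = (if u \<in> X ` {..<K} \<and> v \<in> S then \<omega> v * (g (eig v) (K - Suc (ix u)) x * x $ v) else 0)"

definition A :: "real^'n \<Rightarrow> real^'n^'n" where
  "A x = (\<chi> u v. A0 x $ u $ v + coupling x u v - coupling x v u)"

lemma ix_X: "r < K \<Longrightarrow> ix (X r) = r"
  using inj_X by (simp add: inv_into_f_f)

lemma S_X: "a \<in> S \<Longrightarrow> a \<notin> X ` {..<K}" using XS by auto

lemma Y_X: "j \<le> K \<Longrightarrow> Y j \<notin> X ` {..<K}" using XY by (metis image_iff lessThan_iff)

text \<open>\<open>A0\<close> uses the eigenvalue of the row index; by \<open>B_weight\<close> row
  and column have the same one wherever \<open>B\<close> is nonzero.\<close>

lemma skew_A0: "A0 x $ u $ v = - A0 x $ v $ u"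
  using skew_N[of u v] skew_B[of u v] B_weight[of u v] B_weight[of v u] by (cases "B $ u $ v = 0") (auto simp: A0_def)

lemma skew_A: "A x $ u $ v = - A x $ v $ u"
  using skew_A0[of x u v] by (simp add: A_def)

section \<open>Smoothness of the eigenvalues and of the coefficients\<close>

definition generators :: "(real^'n \<Rightarrow> real) set" where
  "generators = (\<Union>i\<in>I. {lam i, implicit_eigenvalue.W Y K (lam i)})"

text \<open>Including the reciprocals \<open>W\<close> makes all partial derivatives of the
  generators polynomial in the generators and the coordinates.\<close>

lemma generators_partial:
  assumes "f \<in> generators"
  shows "(\<forall>x\<in>U. f differentiable (at x)) \<and> (\<forall>i. partial_at f i \<in> fun_algebra U generators)"
proof -
  obtain k where k: "k \<in> I" "f = lam k \<or> f = implicit_eigenvalue.W Y K (lam k)"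
    using assms by (auto simp: generators_def)
  interpret E: implicit_eigenvalue Y K "c k" U "lam k" by (rule implicit[OF k(1)])
  have "lam k \<in> fun_algebra U generators" "E.W \<in> fun_algebra U generators"
    using k(1) by (auto intro!: fun_algebra.gen simp: generators_def)
  moreover have "E.W differentiable (at x)" if "x \<in> U" for x
    using E.W_has_derivative[OF that] by (rule differentiableI)
  ultimately show ?thesis
    using k(2) E.fun_algebra_partial_l E.fun_algebra_partial_W E.diff_l by auto
qed

lemma Cinf_generated: "f \<in> fun_algebra U generators \<Longrightarrow> Cinf_on U f"
  by (rule fun_algebra_Cinf[OF open_U generators_partial])

lemma Cinf_lam: "i \<in> I \<Longrightarrow> Cinf_on U (lam i)"
  by (rule Cinf_generated) (auto intro!: fun_algebra.gen simp: generators_def)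

lemma fun_algebra_g:
  assumes "k \<in> I"
  shows "g k m \<in> fun_algebra U generators"
proof -
  interpret E: implicit_eigenvalue Y K "c k" U "lam k" by (rule implicit[OF assms])
  show ?thesis using assms
    by (intro E.fun_algebra_G) (auto intro!: fun_algebra.gen simp: generators_def)
qed

lemma fun_algebra_coupling: "(\<lambda>x. coupling x u v) \<in> fun_algebra U generators"
  unfolding coupling_def
  by (cases "u \<in> X ` {..<K} \<and> v \<in> S")
     (auto intro!: fun_algebra.mult fun_algebra.const fun_algebra.coord fun_algebra_g eig)

lemma fun_algebra_A: "(\<lambda>x. A x $ u $ v) \<in> fun_algebra U generators"
proof -
  have "(\<lambda>x. if u \<in> S \<and> v \<in> S then lam (eig u) x * B $ u $ v else 0) \<in> fun_algebra U generators"
    using eig by (cases "u \<in> S \<and> v \<in> S")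
      (auto intro!: fun_algebra.mult fun_algebra.const fun_algebra.gen[of "lam _"] simp: generators_def)
  then have "(\<lambda>x. N $ u $ v + (if u \<in> S \<and> v \<in> S then lam (eig u) x * B $ u $ v else 0)
      + coupling x u v + (-1) * coupling x v u) \<in> fun_algebra U generators"
    by (intro fun_algebra.add fun_algebra.mult fun_algebra.const fun_algebra_coupling)
  then show ?thesis by (simp add: A_def A0_def)
qed

section \<open>The Jacobi identity at a point, for an arbitrary member of the pencil\<close>

context
  fixes \<alpha> \<beta> :: real and x :: "real^'n"
  assumes x: "x \<in> U"
begin

definition P :: "real^'n \<Rightarrow> real^'n^'n" where "P y = \<alpha> *\<^sub>R A y + \<beta> *\<^sub>R B"

definition dcoupling :: "'n \<Rightarrow> 'n \<Rightarrow> real^'n \<Rightarrow> real" where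
  "dcoupling u v z = (if u \<in> X ` {..<K} \<and> v \<in> S then
     \<omega> v * (g (eig v) (K - Suc (ix u)) x * z $ v
       + (\<Sum>j\<le>K. z $ Y j * h (eig v) (K - Suc (ix u) + (K - j)) x) * x $ v) else 0)"

definition dP :: "'n \<Rightarrow> 'n \<Rightarrow> real^'n \<Rightarrow> real" where
  "dP u v z = \<alpha> * ((if u \<in> S \<and> v \<in> S then (\<Sum>j\<le>K. z $ Y j * g (eig u) (K - j) x) * B $ u $ v else 0)
     + dcoupling u v z - dcoupling v u z)"

lemma has_derivative_coupling: "((\<lambda>y. coupling y u v) has_derivative dcoupling u v) (at x)"
proof (cases "u \<in> X ` {..<K} \<and> v \<in> S")
  case True
  interpret E: implicit_eigenvalue Y K "c (eig v)" U "lam (eig v)" using True by (intro implicit eig) simp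
  from True show ?thesis unfolding coupling_def dcoupling_def
    by (simp only: if_True simp_thms) (rule derivative_eq_intros E.G_has_derivative[OF x] E.has_derivative_nth refl)+
next
  case False
  then show ?thesis unfolding coupling_def dcoupling_def by (simp only: if_False) simp
qed

lemma has_derivative_P: "((\<lambda>y. P y $ u $ v) has_derivative dP u v) (at x)"
proof -
  have "((\<lambda>y. if u \<in> S \<and> v \<in> S then lam (eig u) y * B $ u $ v else 0) has_derivative
     (\<lambda>z. if u \<in> S \<and> v \<in> S then (\<Sum>j\<le>K. z $ Y j * g (eig u) (K - j) x) * B $ u $ v else 0)) (at x)"
  proof (cases "u \<in> S \<and> v \<in> S")
    case True
    interpret E: implicit_eigenvalue Y K "c (eig u)" U "lam (eig u)" using True by (intro implicit eig) simp
    from True show ?thesis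
      by (simp only: if_True simp_thms) (rule has_derivative_mult_left E.l_has_derivative[OF x])+
  next
    case False
    then show ?thesis by (simp only: if_False) simp
  qed
  then have "((\<lambda>y. \<alpha> * (N $ u $ v + (if u \<in> S \<and> v \<in> S then lam (eig u) y * B $ u $ v else 0)
      + coupling y u v - coupling y v u) + \<beta> * B $ u $ v) has_derivative dP u v) (at x)"
    unfolding dP_def[abs_def]
    by (auto intro!: derivative_eq_intros has_derivative_coupling)
  then show ?thesis by (simp add: P_def A_def A0_def)
qed

text \<open>As a tangent vector this is the derivation sending a function to its bracket with
  coordinate \<open>i\<close>, up to sign its Hamiltonian vector field.\<close>

definition col :: "'n \<Rightarrow> real^'n" where "col i = (\<chi> l. P x $ l $ i)"

lemma sum_partial_P: "(\<Sum>l\<in>UNIV. P x $ l $ i * partial_at (\<lambda>y. P y $ u $ v) l x) = dP u v (col i)"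
proof -
  interpret bounded_linear "dP u v" using has_derivative_P by (rule has_derivative_bounded_linear)
  have "col i = (\<Sum>l\<in>UNIV. P x $ l $ i *\<^sub>R axis l 1)"
    by (simp add: col_def vec_eq_iff axis_def if_distrib cong: if_cong)
  then have "dP u v (col i) = (\<Sum>l\<in>UNIV. P x $ l $ i * dP u v (axis l 1))"
    by (simp add: sum scaleR)
  then show ?thesis by (simp add: partial_at_eq[OF has_derivative_P])
qed

lemma col_Y: "u \<notin> X ` {..<K} \<Longrightarrow> j \<le> K \<Longrightarrow> col u $ Y j = 0"
  using YS[of j] Y_X[of j] by (auto simp: col_def P_def A_def A0_def coupling_def N_Y B_Y)

lemma col_X_Y: "s < K \<Longrightarrow> j \<le> K \<Longrightarrow> col (X s) $ Y j = - (if j = s then \<alpha> else 0) - (if j = Suc s then \<beta> else 0)"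
  using YS[of j] Y_X[of j] skew_N[of "Y j" "X s"] skew_B[of "Y j" "X s"] inj_onD[OF inj_Y, of j s] inj_onD[OF inj_Y, of j "Suc s"]
  by (auto simp: col_def P_def A_def A0_def coupling_def N_X B_X)

lemma sum_col_X: "s < K \<Longrightarrow> (\<Sum>j\<le>K. col (X s) $ Y j * f j) = - (\<alpha> * f s + \<beta> * f (Suc s))"
proof -
  assume s: "s < K"
  then have "(\<Sum>j\<le>K. col (X s) $ Y j * f j) = (\<Sum>j\<le>K. - (if j = s then \<alpha> * f j else 0) - (if j = Suc s then \<beta> * f j else 0))"
    by (intro sum.cong) (auto simp: col_X_Y)
  then show ?thesis using s by (simp add: sum_subtractf sum_negf)
qed

lemma sum_col_not_X: "u \<notin> X ` {..<K} \<Longrightarrow> (\<Sum>j\<le>K. col u $ Y j * f j) = 0"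
  by (auto simp: col_Y intro!: sum.neutral)

lemma col_S: "a \<in> S \<Longrightarrow> b \<in> S \<Longrightarrow> col b $ a = \<alpha> * (N $ a $ b + lam (eig a) x * B $ a $ b) + \<beta> * B $ a $ b"
  using S_X[of a] S_X[of b] by (auto simp: col_def P_def A_def A0_def coupling_def)

lemma col_X_S: "a \<in> S \<Longrightarrow> r < K \<Longrightarrow> col (X r) $ a = - \<alpha> * (\<omega> a * (g (eig a) (K - Suc r) x * x $ a))"
  using S_X[of a] XS[of r] by (auto simp: col_def P_def A_def A0_def coupling_def N_S B_S ix_X)

lemma col_other_S: "a \<in> S \<Longrightarrow> u \<notin> S \<Longrightarrow> u \<notin> X ` {..<K} \<Longrightarrow> col u $ a = 0"
  using S_X[of a] by (auto simp: col_def P_def A_def A0_def coupling_def N_S B_S)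

definition jac :: "'n \<Rightarrow> 'n \<Rightarrow> 'n \<Rightarrow> real" where
  "jac u v w = dP v w (col u) + dP w u (col v) + dP u v (col w)"

lemma jac_rotate: "jac u v w = jac v w u"
  by (simp add: jac_def)

text \<open>All brackets with such a coordinate are constant, and its Hamiltonian vector field has
  no component along \<open>Y\<close> or \<open>S\<close>, the only coordinates on which
  coefficients depend.\<close>

lemma jac_other:
  assumes "u \<notin> S" "u \<notin> X ` {..<K}"
  shows "jac u v w = 0"
  using assms by (simp add: jac_def dP_def dcoupling_def sum_col_not_X col_other_S)

lemma jac_XXX: "r < K \<Longrightarrow> s < K \<Longrightarrow> t < K \<Longrightarrow> jac (X r) (X s) (X t) = 0"
  using XS by (simp add: jac_def dP_def dcoupling_def)

lemma jac_SSS: "a \<in> S \<Longrightarrow> b \<in> S \<Longrightarrow> d \<in> S \<Longrightarrow> jac a b d = 0"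
  using S_X by (simp add: jac_def dP_def dcoupling_def sum_col_not_X)

text \<open>The two surviving terms differ by sign and by the exchange of \<open>r\<close> and
  \<open>s\<close>. They cancel because second derivatives of the eigenvalue depend only on the sum
  of the indices, expressed by \<open>e\<close>.\<close>

lemma jac_XXS:
  assumes "r < K" "s < K" "a \<in> S"
  shows "jac (X r) (X s) a = 0"
proof -
  have e: "K - Suc s + (K - r) = K - Suc r + (K - s)" "K - Suc s + (K - Suc r) = K - Suc r + (K - Suc s)"
    using assms by auto
  show ?thesis using assms XS S_X
    by (simp add: jac_def dP_def dcoupling_def sum_col_X col_X_S ix_X e) (simp add: algebra_simps)
qed

text \<open>The field of \<open>X r\<close> changes the eigenvalue, and the weights must compensate.
  Where \<open>B $ a $ b\<close> is nonzero the total weight 1 cancels this change; where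
  \<open>N $ a $ b\<close> is nonzero the total weight 0 leaves that entry fixed. The two cases
  exclude each other.\<close>

lemma jac_XSS:
  assumes r: "r < K" and a: "a \<in> S" and b: "b \<in> S"
  shows "jac (X r) a b = 0"
proof -
  let ?G = "\<lambda>i. g i (K - Suc r) x"
  \<comment> \<open>This is the relation that the derivative of an eigenvalue along
    \<open>Y r\<close> is the eigenvalue times its derivative along
    \<open>Y (Suc r)\<close>.\<close>
  have "K - r = Suc (K - Suc r)" using r by auto
  then have G: "g i (K - r) x = lam i x * ?G i" if "i \<in> I" for i
    using implicit_eigenvalue.G_def[OF implicit[OF that]] by simp
  have "jac (X r) a b = - \<alpha> * (\<alpha> * lam (eig a) x + \<beta>) * ?G (eig a) * B $ a $ b
      - \<alpha> * \<omega> b * ?G (eig b) * (col a $ b) + \<alpha> * \<omega> a * ?G (eig a) * (col b $ a)"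
    using r a b XS S_X eig
    by (simp add: jac_def dP_def dcoupling_def sum_col_X sum_col_not_X ix_X G) (simp add: algebra_simps)
  also have "col a $ b = - col b $ a"
    using skew_A[of x a b] skew_B[of a b] by (simp add: col_def P_def)
  also have "- \<alpha> * (\<alpha> * lam (eig a) x + \<beta>) * ?G (eig a) * B $ a $ b
      - \<alpha> * \<omega> b * ?G (eig b) * (- col b $ a) + \<alpha> * \<omega> a * ?G (eig a) * (col b $ a) = 0"
  proof (cases "B $ a $ b = 0 \<and> N $ a $ b = 0")
    case True
    then show ?thesis using a b by (simp add: col_S)
  next
    case False
    then have e: "eig b = eig a" and w: "N $ a $ b = 0 \<and> \<omega> b = 1 - \<omega> a \<or> B $ a $ b = 0 \<and> \<omega> b = - \<omega> a"
      using N_weight[OF a b] B_weight[OF a b]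
      by (auto, (cases "N $ a $ b = 0"; force)+)
    from w show ?thesis
    proof
      assume *: "N $ a $ b = 0 \<and> \<omega> b = 1 - \<omega> a"
      show ?thesis unfolding e col_S[OF a b] conjunct1[OF *] conjunct2[OF *] by (simp add: algebra_simps)
    next
      assume *: "B $ a $ b = 0 \<and> \<omega> b = - \<omega> a"
      show ?thesis unfolding e conjunct1[OF *] conjunct2[OF *] by (simp add: algebra_simps)
    qed
  qed
  finally show ?thesis .
qed

lemma jac_zero: "jac u v w = 0"
proof -
  have "jac u v w = 0" if "u \<in> X ` {..<K}" "v \<in> X ` {..<K} \<union> S" "w \<in> X ` {..<K} \<union> S" for u v w
    using that jac_XXX jac_XXS jac_XSS jac_XXS[of _ _ v] jac_rotate[of u v w] jac_rotate[of w u v] by auto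
  moreover have "jac u v w = 0" if "u \<in> S" "v \<in> S" "w \<in> S" using that by (rule jac_SSS)
  ultimately show ?thesis
    using jac_other[of u v w] jac_other[of v w u] jac_other[of w u v] jac_rotate[of u v w] jac_rotate[of v w u]
    by (metis UnCI)
qed

lemma jacobi_P:
  "(\<Sum>l\<in>UNIV. P x $ l $ i * partial_at (\<lambda>y. P y $ j $ k) l x
            + P x $ l $ j * partial_at (\<lambda>y. P y $ k $ i) l x
            + P x $ l $ k * partial_at (\<lambda>y. P y $ i $ j) l x) = 0"
  using jac_zero[of i j k] by (simp add: sum.distrib sum_partial_P jac_def)

end

lemma compatible: "compatible_poisson_on U A (\<lambda>x. B)"
  unfolding compatible_poisson_on_def poisson_on_def
proof (intro allI conjI ballI)
  fix \<alpha> \<beta> x i j k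
  show "(\<alpha> *\<^sub>R A x + \<beta> *\<^sub>R B) $ i $ j = - (\<alpha> *\<^sub>R A x + \<beta> *\<^sub>R B) $ j $ i"
    using skew_A[of x i j] skew_B[of i j] by simp
  have "(\<lambda>x. \<alpha> * A x $ i $ j + \<beta> * B $ i $ j) \<in> fun_algebra U generators"
    by (intro fun_algebra.add fun_algebra.mult fun_algebra.const fun_algebra_A)
  then show "Cinf_on U (\<lambda>x. (\<alpha> *\<^sub>R A x + \<beta> *\<^sub>R B) $ i $ j)"
    using Cinf_generated by simp
  assume "x \<in> U"
  then show "(\<Sum>l\<in>UNIV. (\<alpha> *\<^sub>R A x + \<beta> *\<^sub>R B) $ l $ i * partial_at (\<lambda>y. (\<alpha> *\<^sub>R A y + \<beta> *\<^sub>R B) $ j $ k) l x +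
      (\<alpha> *\<^sub>R A x + \<beta> *\<^sub>R B) $ l $ j * partial_at (\<lambda>y. (\<alpha> *\<^sub>R A y + \<beta> *\<^sub>R B) $ k $ i) l x +
      (\<alpha> *\<^sub>R A x + \<beta> *\<^sub>R B) $ l $ k * partial_at (\<lambda>y. (\<alpha> *\<^sub>R A y + \<beta> *\<^sub>R B) $ i $ j) l x) = 0"
    using jacobi_P[of x \<alpha> \<beta> i j k] by (simp add: P_def)
qed

section \<open>Removal of the coupling at each point\<close>

lemma normal_form:
  obtains C where "invertible C" "transpose C ** cmat (A x) ** C = cmat (A0 x)" "transpose C ** cmat B ** C = cmat B"
proof (rule remove_coupling[of "cmat (A x)" "cmat (A0 x)" "cmat B"])
  show "cmat (A x) $ a $ b = - cmat (A x) $ b $ a" for a b using skew_A[of x a b] by (simp add: cmat_def)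
  show "cmat (A0 x) $ a $ b = - cmat (A0 x) $ b $ a" for a b using skew_A0[of x a b] by (simp add: cmat_def)
  show "cmat B $ a $ b = - cmat B $ b $ a" for a b using skew_B[of a b] by (simp add: cmat_def)
  show "cmat (A0 x) $ X r $ v = (if v = Y r then 1 else 0)" if "r < K" for r v
    using XS[OF that] by (simp add: cmat_def A0_def N_X[OF that])
  show "(\<Sum>d\<in>S. cmat B $ a $ d * cmat B $ d $ b) = (if a = b then -1 else 0)" if "a \<in> S" "b \<in> S" for a b
    using arg_cong[OF B_square[OF that], of complex_of_real] by (simp add: cmat_def)
qed (use S_X YS in \<open>auto simp: cmat_def A_def A0_def coupling_def N_S B_S B_X N_Y B_Y intro: that\<close>)

end

section \<open>Block diagonal normal forms\<close>

definition total_size :: "(nat \<times> 'b) list \<Rightarrow> nat" where "total_size bs = sum_list (map fst bs)"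

lemma total_size_simps [simp]: "total_size [] = 0" "total_size (b # bs) = fst b + total_size bs" "total_size (bs @ bs') = total_size bs + total_size bs'"
  by (auto simp: total_size_def)

lemma blockdiag_append:
  "blockdiag (bs @ bs') a b =
     (if a < total_size bs \<and> b < total_size bs then blockdiag bs a b
      else if total_size bs \<le> a \<and> total_size bs \<le> b then blockdiag bs' (a - total_size bs) (b - total_size bs) else 0)"
  by (induction bs a b rule: blockdiag.induct) (auto simp: le_diff_conv2)

lemma offblock_skew: "offblock m F a b = - offblock m F b a"
  by (auto simp: offblock_def)

lemma blockdiag_skew:
  assumes "\<And>m F a b. (m, F) \<in> set bs \<Longrightarrow> F a b = - F b a"
  shows "blockdiag bs a b = - blockdiag bs b a"
  using assms
proof (induction bs a b rule: blockdiag.induct)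
  case (2 m F bs r s)
  have "F r s = - F s r" by (rule 2(2)[of m]) simp
  moreover have "blockdiag bs (r - m) (s - m) = - blockdiag bs (s - m) (r - m)"
    if "\<not> (r < m \<and> s < m)" "m \<le> r \<and> m \<le> s" using 2 that by auto
  ultimately show ?case by auto
qed auto

lemma blockdiag_real:
  assumes "\<And>m F a b. (m, F) \<in> set bs \<Longrightarrow> F a b \<in> \<real>"
  shows "blockdiag bs a b \<in> \<real>"
  using assms
proof (induction bs a b rule: blockdiag.induct)
  case (2 m F bs r s)
  have "F r s \<in> \<real>" by (rule 2(2)[of m]) simp
  moreover have "blockdiag bs (r - m) (s - m) \<in> \<real>"
    if "\<not> (r < m \<and> s < m)" "m \<le> r \<and> m \<le> s" using 2 that by auto
  ultimately show ?case by auto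
qed auto

text \<open>A list of pairs (index of the eigenvalue, half the size) describes a direct sum of Jordan blocks.\<close>

definition jordan_As :: "(nat \<Rightarrow> complex) \<Rightarrow> (nat \<times> nat) list \<Rightarrow> (nat \<times> (nat \<Rightarrow> nat \<Rightarrow> complex)) list" where
  "jordan_As \<mu> L = map (\<lambda>(i, m). jordan_A (\<mu> i) m) L"

definition jordan_Bs :: "(nat \<times> nat) list \<Rightarrow> (nat \<times> (nat \<Rightarrow> nat \<Rightarrow> complex)) list" where
  "jordan_Bs L = map (\<lambda>(i, m). jordan_B m) L"

definition jordan_size :: "(nat \<times> nat) list \<Rightarrow> nat" where "jordan_size L = (\<Sum>(i, m)\<leftarrow>L. 2 * m)"

fun eigen_index :: "(nat \<times> nat) list \<Rightarrow> nat \<Rightarrow> nat" where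
  "eigen_index [] a = 0"
| "eigen_index ((i, m) # L) a = (if a < 2 * m then i else eigen_index L (a - 2 * m))"

text \<open>Row \<open>r\<close> has weight \<open>r\<close> and index \<open>m + c\<close> has
  weight \<open>1 - c\<close>. Entries of \<open>B\<close> have \<open>c = r\<close>, total 1;
  nilpotent entries of \<open>A\<close> have \<open>c = r + 1\<close>, total 0.\<close>

fun weight :: "(nat \<times> nat) list \<Rightarrow> nat \<Rightarrow> real" where
  "weight [] a = 0"
| "weight ((i, m) # L) a =
    (if a < m then real a else if a < 2 * m then 1 + real m - real a else weight L (a - 2 * m))"

text \<open>On the Jordan part \<open>B\<close> is a signed permutation matrix; this is its
  involution, and \<open>partner_sign\<close> gives the signs.\<close>

fun partner :: "(nat \<times> nat) list \<Rightarrow> nat \<Rightarrow> nat" where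
  "partner [] a = a"
| "partner ((i, m) # L) a =
    (if a < m then a + m else if a < 2 * m then a - m else 2 * m + partner L (a - 2 * m))"

fun partner_sign :: "(nat \<times> nat) list \<Rightarrow> nat \<Rightarrow> complex" where
  "partner_sign [] a = 1"
| "partner_sign ((i, m) # L) a =
    (if a < m then 1 else if a < 2 * m then -1 else partner_sign L (a - 2 * m))"

lemma total_size_jordan [simp]: "total_size (jordan_As \<mu> L) = jordan_size L" "total_size (jordan_Bs L) = jordan_size L"
  by (induction L) (auto simp: jordan_As_def jordan_Bs_def jordan_size_def jordan_A_def jordan_B_def)

lemma eigen_index_mem: "a < jordan_size L \<Longrightarrow> eigen_index L a \<in> fst ` set L"
  by (induction L a rule: eigen_index.induct) (auto simp: jordan_size_def)

text \<open>A Jordan block is its eigenvalue times the identity plus a nilpotent block. This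
  separates the variable eigenvalues from the constant part of \<open>A\<close>.\<close>

lemma blockdiag_jordan_As:
  "blockdiag (jordan_As \<mu> L) a b =
     \<mu> (eigen_index L a) * blockdiag (jordan_Bs L) a b + blockdiag (jordan_As (\<lambda>_. 0) L) a b"
proof (induction L arbitrary: a b)
  case (Cons x L)
  obtain i m where x: "x = (i, m)" by (cases x)
  show ?case
    using Cons.IH[of "a - 2 * m" "b - 2 * m"]
    by (simp add: x jordan_As_def jordan_Bs_def jordan_A_def jordan_B_def offblock_def)
qed (simp add: jordan_As_def jordan_Bs_def)

lemma weight_jordan_Bs:
  "blockdiag (jordan_Bs L) a b \<noteq> 0 \<Longrightarrow> eigen_index L a = eigen_index L b \<and> weight L a + weight L b = 1"
proof (induction L arbitrary: a b)
  case (Cons x L)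
  obtain i m where x: "x = (i, m)" by (cases x)
  show ?case
    using Cons.prems Cons.IH[of "a - 2 * m" "b - 2 * m"]
    by (auto simp: x jordan_Bs_def jordan_B_def offblock_def of_nat_diff split: if_splits)
qed (simp add: jordan_Bs_def)

lemma weight_jordan_As:
  "blockdiag (jordan_As (\<lambda>_. 0) L) a b \<noteq> 0 \<Longrightarrow>
     eigen_index L a = eigen_index L b \<and> weight L a + weight L b = 0"
proof (induction L arbitrary: a b)
  case (Cons x L)
  obtain i m where x: "x = (i, m)" by (cases x)
  show ?case
    using Cons.prems Cons.IH[of "a - 2 * m" "b - 2 * m"]
    by (auto simp: x jordan_As_def jordan_A_def offblock_def of_nat_diff split: if_splits)
qed (simp add: jordan_As_def)

lemma partner:
  "a < jordan_size L \<Longrightarrow> partner L a < jordan_size L \<and> partner L (partner L a) = a \<and>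
     partner_sign L a * partner_sign L (partner L a) = -1 \<and>
     (\<forall>b. blockdiag (jordan_Bs L) a b = (if b = partner L a then partner_sign L a else 0))"
proof (induction L arbitrary: a)
  case (Cons x L)
  obtain i m where x: "x = (i, m)" by (cases x)
  show ?case
  proof (cases "a < 2 * m")
    case True
    then show ?thesis
      by (auto simp: x jordan_Bs_def jordan_B_def jordan_size_def offblock_def)
  next
    case False
    then have "a - 2 * m < jordan_size L" using Cons.prems by (auto simp: x jordan_size_def)
    from Cons.IH[OF this] False show ?thesis
      by (auto simp: x jordan_Bs_def jordan_B_def jordan_size_def offblock_def)
  qed
qed (simp add: jordan_size_def)

lemma jordan_Bs_square:
  assumes "a < jordan_size L"
  shows "(\<Sum>c<jordan_size L. blockdiag (jordan_Bs L) a c * blockdiag (jordan_Bs L) c b) = (if a = b then -1 else 0)"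
proof -
  have "(\<Sum>c<jordan_size L. blockdiag (jordan_Bs L) a c * blockdiag (jordan_Bs L) c b)
     = (\<Sum>c<jordan_size L. if c = partner L a then partner_sign L a * blockdiag (jordan_Bs L) c b else 0)"
    using partner[OF assms] by (intro sum.cong) auto
  also have "\<dots> = partner_sign L a * blockdiag (jordan_Bs L) (partner L a) b"
    using partner[OF assms] by simp
  also have "\<dots> = (if a = b then -1 else 0)"
    using partner[OF assms] partner[of "partner L a" L] by auto
  finally show ?thesis .
qed

lemma blockdiag_kron_A_Cons:
  assumes "k \<ge> 1"
  shows "r < k - 1 \<Longrightarrow> blockdiag (kron_A k # bs) r v = (if v = k - 1 + r then 1 else 0)"
    and "k - 1 \<le> a \<Longrightarrow> a < 2 * k - 1 \<Longrightarrow> k - 1 \<le> v \<Longrightarrow> blockdiag (kron_A k # bs) a v = 0"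
  using assms by (auto simp: kron_A_def offblock_def)

lemma blockdiag_kron_B_Cons:
  assumes "k \<ge> 1"
  shows "r < k - 1 \<Longrightarrow> blockdiag (kron_B k # bs) r v = (if v = k + r then 1 else 0)"
    and "k - 1 \<le> a \<Longrightarrow> a < 2 * k - 1 \<Longrightarrow> k - 1 \<le> v \<Longrightarrow> blockdiag (kron_B k # bs) a v = 0"
  using assms by (auto simp: kron_B_def offblock_def)

definition jordan_blocks :: "nat \<Rightarrow> (nat \<Rightarrow> nat) \<Rightarrow> (nat \<Rightarrow> nat \<Rightarrow> nat) \<Rightarrow> (nat \<times> nat) list" where
  "jordan_blocks p s n = concat (map (\<lambda>i. map (\<lambda>j. (i, n i j)) [1..<s i + 1]) [1..<p + 1])"

lemma jordan_As_blocks: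
  "jordan_As \<mu> (jordan_blocks p s n) =
     concat (map (\<lambda>i. map (\<lambda>j. jordan_A (\<mu> i) (n i j)) [1..<s i + 1]) [1..<p + 1])"
  by (simp add: jordan_As_def jordan_blocks_def map_concat o_def)

lemma jordan_Bs_blocks:
  "jordan_Bs (jordan_blocks p s n) =
     concat (map (\<lambda>i. map (\<lambda>j. jordan_B (n i j)) [1..<s i + 1]) [1..<p + 1])"
  by (simp add: jordan_Bs_def jordan_blocks_def map_concat o_def)

lemma jordan_size_blocks: "jordan_size (jordan_blocks p s n) = (\<Sum>i=1..p. \<Sum>j=1..s i. 2 * n i j)"
proof -
  have "jordan_size (concat Ls) = (\<Sum>L\<leftarrow>Ls. jordan_size L)" for Ls
    by (induction Ls) (auto simp: jordan_size_def)
  moreover have "{1..<Suc m} = {1..m}" for m by auto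
  ultimately show ?thesis
    by (simp add: jordan_blocks_def o_def jordan_size_def interv_sum_list_conv_sum_set_nat del: upt_Suc)
qed

lemma fst_jordan_blocks: "fst ` set (jordan_blocks p s n) \<subseteq> {1..p}"
  by (auto simp: jordan_blocks_def)

lemma total_size_kron: "total_size (map (\<lambda>j. kron_A (k j)) [1..<q + 1]) = (\<Sum>j=1..q. 2 * k j - 1)"
proof -
  have "{1..<Suc m} = {1..m}" for m by auto
  then show ?thesis
    by (simp add: total_size_def kron_A_def o_def interv_sum_list_conv_sum_set_nat del: upt_Suc)
qed

section \<open>A common domain for the eigenvalues, and the pencil with prescribed
  invariants\<close>

lemma implicit_eigenvalues:
  fixes Y :: "nat \<Rightarrow> 'n::finite"
  assumes inj: "inj_on Y {..K}"
  obtains U :: "(real^'n) set" and lam where "open U" "U \<noteq> {}"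
    "\<And>i. i \<in> {1..p} \<Longrightarrow> implicit_eigenvalue Y K (real i) U (lam i)"
    "\<And>i x. i \<in> {1..p} \<Longrightarrow> x \<in> U \<Longrightarrow> \<bar>lam i x - real i\<bar> < 1/2"
proof -
  define good where "good i V l \<longleftrightarrow> open V \<and> (0::real^'n) \<in> V \<and> (\<forall>x\<in>V. l differentiable (at x)) \<and>
    (\<forall>x\<in>V. l x = real i + (\<Sum>j\<le>K. x $ Y j * l x ^ (K - j))) \<and> (\<forall>x\<in>V. \<bar>l x - real i\<bar> < 1/2)" for i V l
  have "\<exists>V l. good i V l" for i
    by (rule implicit_eigenvalue_exists[OF inj, of "real i"]) (unfold good_def, blast)
  then obtain V lam where "\<And>i. good i (V i) (lam i)" by metis
  note V = this[unfolded good_def]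
  \<comment> \<open>Every \<open>V i\<close> contains 0, so this finite intersection is open and
    nonempty.\<close>
  let ?U = "\<Inter>i\<in>{1..p}. V i"
  have o: "open ?U" using V by (intro open_INT) auto
  show thesis
  proof
    show "open ?U" by fact
    show "?U \<noteq> {}" using V by blast
    show "implicit_eigenvalue Y K (real i) ?U (lam i)" if "i \<in> {1..p}" for i
      using V[of i] that inj o by unfold_locales auto
    show "\<bar>lam i x - real i\<bar> < 1/2" if "i \<in> {1..p}" "x \<in> ?U" for i x
      using V[of i] that by blast
  qed
qed

theorem theorem1:
  fixes p q :: nat and s :: "nat \<Rightarrow> nat" and n :: "nat \<Rightarrow> nat \<Rightarrow> nat" and k :: "nat \<Rightarrow> nat"
  assumes "q \<ge> 1"
    and "\<forall>i\<in>{1..p}. \<forall>j\<in>{1..s i}. n i j \<ge> 1"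
    and "\<forall>i\<in>{1..p}. \<forall>j\<in>{1..s i}. \<forall>j'\<in>{1..s i}. j \<le> j' \<longrightarrow> n i j' \<le> n i j"
    and "\<forall>j\<in>{1..q}. k j \<ge> 1"
    and "CARD('d::finite) = (\<Sum>i=1..p. \<Sum>j=1..s i. 2 * n i j) + (\<Sum>j=1..q. 2 * k j - 1)"
  shows "\<exists>(U :: (real^'d) set) (A :: real^'d \<Rightarrow> real^'d^'d) (B :: real^'d \<Rightarrow> real^'d^'d)
            (lam :: nat \<Rightarrow> real^'d \<Rightarrow> real).
           open U \<and> U \<noteq> {} \<and> compatible_poisson_on U A B \<and>
           (\<forall>x\<in>U. JK_normal_form (cmat (A x)) (cmat (B x)) p (\<lambda>i. complex_of_real (lam i x)) s n q k) \<and>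
           (\<forall>i\<in>{1..p}. Cinf_on U (lam i)) \<and>
           (\<forall>x\<in>U. \<forall>i\<in>{1..p}. \<forall>i'\<in>{1..p}. i \<noteq> i' \<longrightarrow> lam i x \<noteq> lam i' x) \<and>
           (\<forall>x\<in>U. \<forall>i\<in>{1..p}. frechet_derivative (lam i) (at x) \<noteq> (\<lambda>v. 0))"
proof -
  define L where "L = jordan_blocks p s n"
  define J where "J = jordan_size L"
  \<comment> \<open>Only the first Kronecker block drives the eigenvalues; it exists since
    \<open>q \<ge> 1\<close>. If \<open>k 1 = 1\<close> then \<open>K = 0\<close>, there is no
    coupling, and the equation reads \<open>lam i x = real i + x $ Y 0\<close>.\<close>
  define K where "K = k 1 - 1"
  define kA where "kA = map (\<lambda>j. kron_A (k j)) [1..<q + 1]"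
  define kB where "kB = map (\<lambda>j. kron_B (k j)) [1..<q + 1]"
  have k1: "k 1 \<ge> 1" using assms(1,4) by auto
  have upt: "[1..<q + 1] = 1 # [2..<q + 1]" using assms(1) by (subst upt_conv_Cons) (auto simp: numeral_2_eq_2)
  have kAB: "kA = kron_A (k 1) # map (\<lambda>j. kron_A (k j)) [2..<q + 1]"
    "kB = kron_B (k 1) # map (\<lambda>j. kron_B (k j)) [2..<q + 1]"
    unfolding kA_def kB_def upt by auto
  have card: "CARD('d) = J + total_size kA"
    unfolding assms(5) J_def L_def jordan_size_blocks kA_def total_size_kron ..
  have JK: "J + 2 * K + 1 \<le> CARD('d)"
    using k1 by (simp add: card kAB K_def kron_A_def)
  obtain e :: "'d \<Rightarrow> nat" where e: "bij_betw e UNIV {..<CARD('d)}"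
    using ex_bij_betw_finite_nat[of "UNIV :: 'd set"] by (auto simp: atLeast0LessThan)
  define d where "d = inv e"
  have inj_e: "inj e" using e by (rule bij_betw_imp_inj_on)
  have ed: "e (d m) = m" if "m < CARD('d)" for m
    unfolding d_def using that e by (intro f_inv_into_f) (auto simp: bij_betw_def)
  have d_eq: "v = d m \<longleftrightarrow> e v = m" if "m < CARD('d)" for v m
    using ed[OF that] inj_e by (auto dest: injD)
  \<comment> \<open>The enumeration \<open>e\<close> lists the Jordan coordinates first, then
    \<open>X\<close>, \<open>Y\<close>, and finally the other Kronecker blocks.\<close>
  define X where "X r = d (J + r)" for r
  define Y where "Y j = d (J + K + j)" for j
  define S where "S = {u. e u < J}"
  have eX: "e (X r) = J + r" if "r < K" for r using that JK by (simp add: X_def ed)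
  have eY: "e (Y j) = J + K + j" if "j \<le> K" for j using that JK by (simp add: Y_def ed)
  have v_Y: "v = Y j \<longleftrightarrow> e v = J + K + j" if "j \<le> K" for v j using that JK by (simp add: Y_def d_eq)
  have v_X: "v \<in> X ` {..<K} \<longleftrightarrow> J \<le> e v \<and> e v < J + K" for v
  proof -
    have "v \<in> X ` {..<K}" if "J \<le> e v" "e v < J + K"
      using that JK by (intro image_eqI[of _ _ "e v - J"]) (auto simp: X_def d_eq)
    then show ?thesis using eX by auto
  qed
  \<comment> \<open>All eigenvalues are 0 here, so that \<open>N\<close> is constant.\<close>
  define bA where "bA = blockdiag (jordan_As (\<lambda>_. 0) L @ kA)"
  define bB where "bB = blockdiag (jordan_Bs L @ kB)"
  define N :: "real^'d^'d" where "N = (\<chi> u v. Re (bA (e u) (e v)))"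
  define B :: "real^'d^'d" where "B = (\<chi> u v. Re (bB (e u) (e v)))"
  have bA_real: "bA a b \<in> \<real>" for a b unfolding bA_def
    by (rule blockdiag_real)
       (auto simp: jordan_As_def jordan_A_def kA_def kron_A_def offblock_def)
  have bB_real: "bB a b \<in> \<real>" for a b unfolding bB_def
    by (rule blockdiag_real)
       (auto simp: jordan_Bs_def jordan_B_def kB_def kron_B_def offblock_def)
  have bA_skew: "bA a b = - bA b a" for a b unfolding bA_def
    by (rule blockdiag_skew) (auto simp: jordan_As_def jordan_A_def kA_def kron_A_def intro: offblock_skew)
  have bB_skew: "bB a b = - bB b a" for a b unfolding bB_def
    by (rule blockdiag_skew) (auto simp: jordan_Bs_def jordan_B_def kB_def kron_B_def intro: offblock_skew)
  have N: "complex_of_real (N $ u $ v) = bA (e u) (e v)" for u v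
    using bA_real by (simp add: N_def)
  have B: "complex_of_real (B $ u $ v) = bB (e u) (e v)" for u v
    using bB_real by (simp add: B_def)
  have bA_J: "a < J \<Longrightarrow> bA a b = (if b < J then blockdiag (jordan_As (\<lambda>_. 0) L) a b else 0)"
    and bB_J: "a < J \<Longrightarrow> bB a b = (if b < J then blockdiag (jordan_Bs L) a b else 0)"
    and bA_K: "J \<le> a \<Longrightarrow> bA a b = (if J \<le> b then blockdiag kA (a - J) (b - J) else 0)"
    and bB_K: "J \<le> a \<Longrightarrow> bB a b = (if J \<le> b then blockdiag kB (a - J) (b - J) else 0)" for a b
    by (auto simp: bA_def bB_def blockdiag_append J_def)
  have kA_Y: "blockdiag kA (K + j) b = 0" and kB_Y: "blockdiag kB (K + j) b = 0" if "j \<le> K" "K \<le> b" for j b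
    unfolding kAB using that k1 by (auto simp: K_def intro!: blockdiag_kron_A_Cons(2) blockdiag_kron_B_Cons(2))
  have inj_X: "inj_on X {..<K}" using eX by (metis add_left_cancel inj_onI lessThan_iff)
  have inj_Y: "inj_on Y {..K}" using eY by (metis add_left_cancel inj_onI atMost_iff)
  obtain U :: "(real^'d) set" and lam where U: "open U" "U \<noteq> {}"
    and lam: "\<And>i. i \<in> {1..p} \<Longrightarrow> implicit_eigenvalue Y K (real i) U (lam i)"
    and near: "\<And>i x. i \<in> {1..p} \<Longrightarrow> x \<in> U \<Longrightarrow> \<bar>lam i x - real i\<bar> < 1/2"
    by (rule implicit_eigenvalues[OF inj_Y, where p = p]) (rule that, assumption+)
  interpret Kronecker_Jordan_pencil X Y K S U "{1..p}" real lam "\<lambda>u. eigen_index L (e u)" "\<lambda>u. weight L (e u)" N B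
  proof (intro Kronecker_Jordan_pencil.intro Kronecker_split.intro Kronecker_Jordan_pencil_axioms.intro)
    show "inj_on X {..<K}" "inj_on Y {..K}" by fact+
    show "X r \<noteq> Y j" if "r < K" "j \<le> K" for r j using eX[OF that(1)] eY[OF that(2)] that by auto
    show "X r \<notin> S" if "r < K" for r using eX[OF that] by (simp add: S_def)
    show "Y j \<notin> S" if "j \<le> K" for j using eY[OF that] by (simp add: S_def)
    show "open U" by fact
    show "implicit_eigenvalue Y K (real i) U (lam i)" if "i \<in> {1..p}" for i by (rule lam[OF that])
    show "eigen_index L (e a) \<in> {1..p}" if "a \<in> S" for a
      using that eigen_index_mem[of "e a" L] subsetD[OF fst_jordan_blocks] by (simp add: S_def J_def L_def)
    show "N $ a $ b = - N $ b $ a" for a b using bA_skew[of "e a" "e b"] by (simp add: N_def)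
    show "B $ a $ b = - B $ b $ a" for a b using bB_skew[of "e a" "e b"] by (simp add: B_def)
    show "N $ a $ v = 0" if "a \<in> S" "v \<notin> S" for a v using that by (simp add: N_def S_def bA_J)
    show "B $ a $ v = 0" if "a \<in> S" "v \<notin> S" for a v using that by (simp add: B_def S_def bB_J)
    show "N $ X r $ v = (if v = Y r then 1 else 0)" if r: "r < K" for r v
    proof -
      have "bA (J + r) (e v) = (if e v = J + K + r then 1 else 0)"
        using r blockdiag_kron_A_Cons(1)[OF k1] by (auto simp: bA_K kAB K_def)
      then show ?thesis using r by (simp add: N_def eX v_Y)
    qed
    show "B $ X r $ v = (if v = Y (Suc r) then 1 else 0)" if r: "r < K" for r v
    proof -
      have "bB (J + r) (e v) = (if e v = J + K + Suc r then 1 else 0)"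
        using r blockdiag_kron_B_Cons(1)[OF k1] k1 by (auto simp: bB_K kAB K_def)
      then show ?thesis using r by (simp add: B_def eX v_Y)
    qed
    show "N $ Y j $ v = 0" if "j \<le> K" "v \<notin> X ` {..<K}" for j v
      using that kA_Y[of j "e v - J"] by (auto simp: N_def eY bA_K v_X)
    show "B $ Y j $ v = 0" if "j \<le> K" "v \<notin> X ` {..<K}" for j v
      using that kB_Y[of j "e v - J"] by (auto simp: B_def eY bB_K v_X)
    show "eigen_index L (e a) = eigen_index L (e b) \<and> weight L (e a) + weight L (e b) = 0"
      if "a \<in> S" "b \<in> S" "N $ a $ b \<noteq> 0" for a b
      using that by (intro weight_jordan_As) (auto simp: N_def S_def bA_J)
    show "eigen_index L (e a) = eigen_index L (e b) \<and> weight L (e a) + weight L (e b) = 1"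
      if "a \<in> S" "b \<in> S" "B $ a $ b \<noteq> 0" for a b
      using that by (intro weight_jordan_Bs) (auto simp: B_def S_def bB_J)
    show "(\<Sum>c\<in>S. B $ a $ c * B $ c $ b) = (if a = b then -1 else 0)" if "a \<in> S" "b \<in> S" for a b
    proof -
      have bij: "bij_betw e S {..<J}"
        unfolding S_def using inj_e e card
        by (auto simp: bij_betw_def inj_on_def image_iff)
      have "complex_of_real (\<Sum>c\<in>S. B $ a $ c * B $ c $ b) = (\<Sum>c\<in>S. bB (e a) (e c) * bB (e c) (e b))"
        by (simp add: B)
      also have "\<dots> = (\<Sum>m<J. bB (e a) m * bB m (e b))"
        by (rule sum.reindex_bij_betw[OF bij])
      also have "\<dots> = (\<Sum>m<J. blockdiag (jordan_Bs L) (e a) m * blockdiag (jordan_Bs L) m (e b))"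
        using that by (intro sum.cong) (auto simp: bB_J S_def)
      also have "\<dots> = (if a = b then -1 else 0)"
        using that jordan_Bs_square[of "e a" L "e b"] inj_e by (auto simp: S_def J_def dest: injD)
      finally have "complex_of_real (\<Sum>c\<in>S. B $ a $ c * B $ c $ b) = complex_of_real (if a = b then -1 else 0)" by simp
      then show ?thesis by (simp only: of_real_eq_iff)
    qed
  qed
  have "JK_normal_form (cmat (A x)) (cmat B) p (\<lambda>i. complex_of_real (lam i x)) s n q k" for x
  proof -
    obtain C where C: "invertible C" "transpose C ** cmat (A x) ** C = cmat (A0 x)"
      "transpose C ** cmat B ** C = cmat B" by (rule normal_form)
    define \<mu> where "\<mu> i = complex_of_real (lam i x)" for i
    have A0_eq: "cmat (A0 x) $ u $ v = blockdiag (jordan_As \<mu> L @ kA) (e u) (e v)" for u v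
    proof -
      have "cmat (A0 x) $ u $ v = bA (e u) (e v) +
          (if u \<in> S \<and> v \<in> S then \<mu> (eigen_index L (e u)) * bB (e u) (e v) else 0)"
        by (simp add: cmat_def A0_def N B \<mu>_def)
      then show ?thesis
        using blockdiag_jordan_As[of \<mu> L "e u" "e v"]
        by (auto simp: S_def bA_J bB_J bA_def blockdiag_append J_def[symmetric])
    qed
    have B_eq: "cmat B $ u $ v = blockdiag (jordan_Bs L @ kB) (e u) (e v)" for u v
      by (simp add: cmat_def B bB_def)
    have size: "sum_list (map fst (jordan_As \<mu> L @ kA)) = CARD('d)"
      using card by (simp add: total_size_def[symmetric] J_def)
    show ?thesis
      unfolding JK_normal_form_def Let_def jordan_As_blocks[symmetric] jordan_Bs_blocks[symmetric]
        L_def[symmetric] kA_def[symmetric] kB_def[symmetric] \<mu>_def[symmetric]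
      using C e size A0_eq B_eq by (intro exI[of _ C] exI[of _ e]) simp
  qed
  moreover have "lam i x \<noteq> lam i' x" if "x \<in> U" "i \<in> {1..p}" "i' \<in> {1..p}" "i \<noteq> i'" for x i i'
  proof
    \<comment> \<open>The constants \<open>real i\<close> are at distance at least 1, and each
      eigenvalue stays within 1/2 of its own.\<close>
    assume "lam i x = lam i' x"
    then have "\<bar>real i - real i'\<bar> < 1" using near[of i x] near[of i' x] that by linarith
    then show False using that by linarith
  qed
  moreover have "frechet_derivative (lam i) (at x) \<noteq> (\<lambda>v. 0)" if "x \<in> U" "i \<in> {1..p}" for x i
    using implicit_eigenvalue.frechet_derivative_l_nonzero[OF lam[OF that(2)] that(1)] .
  ultimately show ?thesis
    using U compatible Cinf_lam by (intro exI[of _ U] exI[of _ A] exI[of _ "\<lambda>_. B"] exI[of _ lam]) blast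
qed

end
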